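(* Let $p$ be a real number that is not an even integer (in particular $p\neq 0$). Then $$\int_0^1 \log\Gamma(x)\cos(p\pi x)\,dx = \frac{\sin(p\pi)\,[\gamma+\log(2\pi)]}{2p\pi} + \frac{\sin(p\pi)}{4p\pi}\left[\psi\left(\frac{p}{2}\right)+\psi\left(-\frac{p}{2}\right)\right]$$ $$+\frac{2(1-\cos(p\pi))\,[\gamma+\log(2\pi)]}{\pi^2}\left[\frac{1}{2p^2}-\frac{\pi}{4p}\cot\left(\frac{p\pi}{2}\right)\right]+\frac{2(1-\cos(p\pi))}{\pi^2}\sum_{n=1}^{\infty}\frac{\log n}{4n^2-p^2}.$$
   Context: $\Gamma$ is the gamma function, $\psi=\Gamma'/\Gamma$ is the digamma function, $\gamma$ is Euler's constant, and $\log$ is the natural logarithm. *)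

theory Defs
  imports "HOL-Analysis.Analysis"
begin

end

theory Submission
  imports Defs "HOL-Real_Asymp.Real_Asymp"
begin

text \<open>
  The formula is Parseval's identity for the two functions \<open>ln \<Gamma>(x)\<close> and \<open>cos (p\<pi>x)\<close> on \<open>[0,1]\<close>. The
  Fourier coefficients of \<open>ln \<Gamma>\<close> are those of Kummer's series: mean \<open>ln (2\<pi>) / 2\<close>
  (\<open>integral_ln_Gamma\<close>), cosine coefficients \<open>1/(4n)\<close> (\<open>fourier_cos_ln_Gamma\<close>) and sine coefficients
  \<open>(\<gamma> + ln (2\<pi>n)) / (2\<pi>n)\<close> (\<open>fourier_sin_ln_Gamma\<close>). The coefficients of \<open>cos (p\<pi>x)\<close> are elementary,
  with denominators \<open>4n\<^sup>2 - p\<^sup>2\<close> that do not vanish because \<open>p\<close> is not an even integer. Multiplying, one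
  meets three series: \<open>\<Sum> 1/(n(4n\<^sup>2 - p\<^sup>2))\<close>, a value of the digamma function (\<open>Digamma_symmetric_sums\<close>);
  \<open>\<Sum> 1/(4n\<^sup>2 - p\<^sup>2)\<close>, a cotangent (\<open>cot_sums\<close>); and \<open>\<Sum> ln n/(4n\<^sup>2 - p\<^sup>2)\<close>, which stays as it is.

  Parseval's identity (\<open>parseval_C1\<close>) is proved without Hilbert space theory, for a first factor
  that may be singular at the end points. Integration by parts replaces the first factor \<open>u\<close> by its antiderivative,
  which is the integral of \<open>u\<close> against an indicator function, that is, against a difference of two
  sawtooth waves. The Abel means of the sawtooth series are \<open>- Im (Ln (1 - r e\<^sup>2\<^sup>\<pi>\<^sup>i\<^sup>t))\<close>, hence bounded
  by \<open>\<pi>/2\<close>, and dominated convergence gives a convergent trigonometric series for the antiderivative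
  (\<open>fourier_antiderivative\<close>).

  Among the coefficients of \<open>ln \<Gamma>\<close>, the mean follows from the duplication formula, the cosine
  coefficients from the reflection formula, and the sine coefficients from Euler's series for \<open>ln \<Gamma>\<close>.
  The last series turns them into values of \<open>Cin t = \<integral>\<^sub>0\<^sup>t (1 - cos u)/u du\<close>, and Euler's constant enters
  through the asymptotics \<open>Cin (\<pi>M) = \<gamma> + ln (\<pi>M) + o(1)\<close> (\<open>Cin_asymptotics\<close>).
\<close>

section \<open>Abel means of the sawtooth series\<close>

text \<open>
  The Abel means \<open>\<Sum>n. r\<^sup>n sin (2\<pi>nt) / n\<close> of the Fourier series of the sawtooth \<open>\<pi>(1/2 - t)\<close>.
  The logarithm is a closed form of that sum which makes both its boundedness and its limit as
  \<open>r\<close> tends to 1 visible. Here and below, series with the factor \<open>1 / real n\<close> start at \<open>n = 0\<close>, where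
  the convention \<open>x / 0 = 0\<close> makes the term vanish.
\<close>

definition abel_saw :: "real \<Rightarrow> real \<Rightarrow> real" where
  "abel_saw r t = - Im (Ln (1 - of_real r * cis (2 * pi * t)))"

lemma abel_saw_sums:
  assumes "0 \<le> r" "r < 1"
  shows "(\<lambda>n. r ^ n * (sin (2 * pi * real n * t) / real n)) sums abel_saw r t"
proof -
  let ?w = "of_real r * cis (2 * pi * t)"
  have "cmod (- ?w) < 1" using assms by (simp add: norm_mult)
  from Ln_series'[OF this] have "(\<lambda>n. - (?w ^ n) / of_nat n) sums Ln (1 - ?w)" by simp
  then have "(\<lambda>n. - Im (- (?w ^ n) / of_nat n)) sums (- Im (Ln (1 - ?w)))"
    by (intro sums_minus sums_Im)
  moreover have "- Im (- (?w ^ n) / of_nat n) = r ^ n * (sin (2 * pi * real n * t) / real n)" for n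
  proof -
    have "?w ^ n = of_real (r ^ n) * cis (real n * (2 * pi * t))"
      by (simp only: power_mult_distrib of_real_power Complex.DeMoivre)
    then have "Im (?w ^ n) = r ^ n * sin (2 * pi * real n * t)"
      by (simp add: mult_ac)
    then show ?thesis by simp
  qed
  ultimately show ?thesis unfolding abel_saw_def by (simp only:)
qed

lemma one_minus_cis_pos:
  assumes "0 \<le> r" "r < 1"
  shows "0 < Re (1 - of_real r * cis a)"
proof -
  have "r * cos a \<le> r * 1" using assms by (intro mult_left_mono) auto
  then show ?thesis using assms by simp
qed

text \<open>
  The point \<open>1 - r e\<^sup>i\<^sup>a\<close> lies in the right half plane, so its argument is at most \<open>\<pi>/2\<close> in modulus.
  This bound, uniform in \<open>r\<close> and \<open>t\<close>, is what lets an arbitrary integrable function be integrated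
  against the sawtooth series.
\<close>

lemma abel_saw_bound:
  assumes "0 \<le> r" "r < 1"
  shows "\<bar>abel_saw r t\<bar> \<le> pi / 2"
  using Re_Ln_pos_lt_imp[OF one_minus_cis_pos[OF assms]] by (simp add: abel_saw_def less_imp_le)

text \<open>
  Polar form: \<open>1 - e\<^sup>2\<^sup>i\<^sup>a = 2 sin a \<cdot> e\<^sup>i\<^sup>(\<^sup>a\<^sup>-\<^sup>\<pi>\<^sup>/\<^sup>2\<^sup>)\<close> with \<open>a = \<pi>t\<close>, and the exponent is in the
  principal range for \<open>0 < t < 1\<close>.
\<close>

lemma Im_Ln_one_minus_cis:
  assumes "0 < t" "t < 1"
  shows "- Im (Ln (1 - cis (2 * pi * t))) = pi * (1/2 - t)"
proof -
  let ?z = "Complex (ln (2 * sin (pi * t))) (pi * t - pi / 2)"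
  have s: "sin (pi * t) > 0" using assms by (intro sin_gt_zero) auto
  have c2: "cos (2 * pi * t) = 1 - 2 * (sin (pi * t))\<^sup>2"
    using cos_double_sin[of "pi * t"] by (simp add: mult_ac)
  have s2: "sin (2 * pi * t) = 2 * sin (pi * t) * cos (pi * t)"
    using sin_double[of "pi * t"] by (simp add: mult_ac)
  have "exp ?z = 1 - cis (2 * pi * t)"
    using s by (simp add: complex_eq_iff Re_exp Im_exp c2 s2 cos_diff sin_diff power2_eq_square)
  moreover have "pi * t < pi" using assms by simp
  moreover have "pi * t > 0" using assms by simp
  ultimately have "Ln (1 - cis (2 * pi * t)) = ?z"
    using pi_gt_zero by (intro Ln_unique) (assumption | simp only: complex.sel | linarith)+
  then show ?thesis by (simp add: algebra_simps)
qed

lemma abel_saw_tendsto: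
  assumes t: "0 < t" "t < 1" and r: "r \<longlonglongrightarrow> 1"
  shows "(\<lambda>k. abel_saw (r k) t) \<longlonglongrightarrow> pi * (1/2 - t)"
proof -
  have "(sin (pi * t))\<^sup>2 > 0" using sin_gt_zero[of "pi * t"] t by simp
  then have "cos (2 * pi * t) < 1"
    using cos_double_sin[of "pi * t"] by (simp add: mult_ac)
  then have "1 - cis (2 * pi * t) \<notin> \<real>\<^sub>\<le>\<^sub>0" by (simp add: complex_nonpos_Reals_iff)
  moreover have "(\<lambda>k. 1 - of_real (r k) * cis (2 * pi * t)) \<longlonglongrightarrow> 1 - of_real 1 * cis (2 * pi * t)"
    using r by (intro tendsto_intros)
  ultimately have "(\<lambda>k. abel_saw (r k) t) \<longlonglongrightarrow> - Im (Ln (1 - cis (2 * pi * t)))"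
    unfolding abel_saw_def of_real_1 mult_1 by (intro tendsto_minus tendsto_Im tendsto_Ln)
  then show ?thesis using Im_Ln_one_minus_cis[OF t] by simp
qed

lemma abel_saw_periodic: "abel_saw r (t + 1) = abel_saw r t"
proof -
  have "cis (2 * pi * (t + 1)) = cis (2 * pi * t) * cis (2 * pi)"
    by (simp add: cis_mult algebra_simps)
  then show ?thesis by (simp add: abel_saw_def)
qed

text \<open>
  The difference of two shifted sawtooth waves is \<open>\<pi>\<close> times the indicator function of \<open>[0, x)\<close> minus
  its mean: the linear parts cancel, and the shifted wave jumps at \<open>x\<close>.
\<close>

lemma abel_saw_diff_tendsto:
  assumes "0 \<le> x" "x \<le> 1" "0 < t" "t < 1" "t \<noteq> x" and r: "r \<longlonglongrightarrow> 1"
  shows "(\<lambda>k. abel_saw (r k) t - abel_saw (r k) (t - x)) \<longlonglongrightarrow> pi * ((if t < x then 1 else 0) - x)"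
proof (cases "t < x")
  case True
  have "(\<lambda>k. abel_saw (r k) t - abel_saw (r k) (t - x + 1)) \<longlonglongrightarrow> pi * (1/2 - t) - pi * (1/2 - (t - x + 1))"
    using assms True by (intro tendsto_diff abel_saw_tendsto) auto
  then show ?thesis using True unfolding abel_saw_periodic by (simp add: algebra_simps)
next
  case False
  have "(\<lambda>k. abel_saw (r k) t - abel_saw (r k) (t - x)) \<longlonglongrightarrow> pi * (1/2 - t) - pi * (1/2 - (t - x))"
    using assms False by (intro tendsto_diff abel_saw_tendsto) auto
  then show ?thesis using False by (simp add: algebra_simps)
qed

section \<open>Fourier coefficients and Parseval's identity\<close>

definition fourier_cos :: "(real \<Rightarrow> real) \<Rightarrow> nat \<Rightarrow> real" where
  "fourier_cos u n = integral {0..1} (\<lambda>x. u x * cos (2 * pi * real n * x))"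

definition fourier_sin :: "(real \<Rightarrow> real) \<Rightarrow> nat \<Rightarrow> real" where
  "fourier_sin u n = integral {0..1} (\<lambda>x. u x * sin (2 * pi * real n * x))"

lemma abs_integrable_mult_continuous:
  fixes u g :: "real \<Rightarrow> real"
  assumes "u absolutely_integrable_on {a..b}" "continuous_on {a..b} g"
  shows "(\<lambda>x. u x * g x) absolutely_integrable_on {a..b}"
proof -
  have "(\<lambda>x. g x * u x) absolutely_integrable_on {a..b}"
  proof (rule absolutely_integrable_bounded_measurable_product_real)
    show "g \<in> borel_measurable (lebesgue_on {a..b})"
      using assms by (intro continuous_imp_measurable_on_sets_lebesgue) auto
    show "bounded (g ` {a..b})"
      using assms by (intro compact_imp_bounded compact_continuous_image) auto
  qed (use assms in auto)
  then show ?thesis by (simp add: mult.commute)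
qed

lemma fourier_cos_integrable:
  "u absolutely_integrable_on {0..1} \<Longrightarrow> (\<lambda>x. u x * cos (2 * pi * real n * x)) integrable_on {0..1}"
  by (intro set_lebesgue_integral_eq_integral(1) abs_integrable_mult_continuous continuous_intros)

lemma fourier_sin_integrable:
  "u absolutely_integrable_on {0..1} \<Longrightarrow> (\<lambda>x. u x * sin (2 * pi * real n * x)) integrable_on {0..1}"
  by (intro set_lebesgue_integral_eq_integral(1) abs_integrable_mult_continuous continuous_intros)

lemma has_integral_sums_dominated:
  fixes f :: "nat \<Rightarrow> real \<Rightarrow> real"
  assumes "\<And>n. (f n has_integral y n) {a..b}" and u: "(\<lambda>x. \<bar>u x\<bar>) integrable_on {a..b}"
    and bd: "\<And>n x. x \<in> {a..b} \<Longrightarrow> \<bar>f n x\<bar> \<le> M n * \<bar>u x\<bar>" and M: "summable M" "\<And>n. 0 \<le> M n"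
    and lim: "\<And>x. x \<in> {a..b} \<Longrightarrow> (\<lambda>n. f n x) sums g x"
  shows "g integrable_on {a..b}" and "y sums integral {a..b} g"
proof -
  have F: "((\<lambda>x. \<Sum>n<N. f n x) has_integral (\<Sum>n<N. y n)) {a..b}" for N
    by (intro has_integral_sum assms) auto
  have le: "norm (\<Sum>n<N. f n x) \<le> suminf M * \<bar>u x\<bar>" if "x \<in> {a..b}" for N x
  proof -
    have "norm (\<Sum>n<N. f n x) \<le> (\<Sum>n<N. M n * \<bar>u x\<bar>)"
      using bd[OF that] by (intro order_trans[OF norm_sum] sum_mono) auto
    also have "\<dots> = (\<Sum>n<N. M n) * \<bar>u x\<bar>" by (simp add: sum_distrib_right)
    also have "\<dots> \<le> suminf M * \<bar>u x\<bar>"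
      using M by (intro mult_right_mono sum_le_suminf) auto
    finally show ?thesis .
  qed
  have h: "(\<lambda>x. suminf M * \<bar>u x\<bar>) integrable_on {a..b}"
    using integrable_cmul[OF u, of "suminf M"] by simp
  have "g integrable_on {a..b} \<and> (\<lambda>N. integral {a..b} (\<lambda>x. \<Sum>n<N. f n x)) \<longlonglongrightarrow> integral {a..b} g"
    using dominated_convergence[of "\<lambda>N x. \<Sum>n<N. f n x" "{a..b}", OF _ h le] F lim
    unfolding sums_def by blast
  moreover have "integral {a..b} (\<lambda>x. \<Sum>n<N. f n x) = (\<Sum>n<N. y n)" for N
    using F by (rule integral_unique)
  ultimately show "g integrable_on {a..b}" and "y sums integral {a..b} g"
    by (auto simp: sums_def)
qed

lemma abs_antiderivative_term_le:
  "\<bar>(a * (1 - cos y) + b * sin y) / real n\<bar> \<le> 2 * (\<bar>a\<bar> / real n) + \<bar>b\<bar> / real n"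
proof -
  have "\<bar>a * (1 - cos y)\<bar> \<le> \<bar>a\<bar> * 2"
    unfolding abs_mult using cos_ge_minus_one[of y] cos_le_one[of y] by (intro mult_left_mono) auto
  moreover have "\<bar>b * sin y\<bar> \<le> \<bar>b\<bar> * 1"
    unfolding abs_mult by (intro mult_left_mono) auto
  ultimately have "\<bar>a * (1 - cos y) + b * sin y\<bar> / real n \<le> (\<bar>a\<bar> * 2 + \<bar>b\<bar> * 1) / real n"
    by (intro divide_right_mono) auto
  then show ?thesis unfolding abs_divide abs_of_nat by (simp add: add_divide_distrib mult.commute)
qed

text \<open>
  The Fourier series of the antiderivative of \<open>u\<close> (with its linear part removed) converges to it
  pointwise. Indeed \<open>\<integral>\<^sub>0\<^sup>x u - x \<integral>\<^sub>0\<^sup>1 u\<close> is the integral of \<open>u\<close> against the indicator function of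
  \<open>[0, x)\<close> minus its mean, which is the bounded limit of Abel means of a sine series. For fixed \<open>r < 1\<close> the
  series may be integrated term by term; then \<open>r\<close> tends to 1, on the integral side by dominated
  convergence and on the series side by Tannery's theorem, where the summability hypotheses enter.
\<close>

lemma fourier_antiderivative:
  assumes u: "u absolutely_integrable_on {0..1}"
    and sC: "summable (\<lambda>n. \<bar>fourier_cos u n\<bar> / real n)"
    and sS: "summable (\<lambda>n. \<bar>fourier_sin u n\<bar> / real n)"
    and x: "0 \<le> x" "x \<le> 1"
  shows "(\<lambda>n. (fourier_sin u n * (1 - cos (2 * pi * real n * x))
               + fourier_cos u n * sin (2 * pi * real n * x)) / real n)
     sums (pi * (integral {0..x} u - x * integral {0..1} u))"
proof -
  define d where "d n = (fourier_sin u n * (1 - cos (2 * pi * real n * x))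
               + fourier_cos u n * sin (2 * pi * real n * x)) / real n" for n
  define r where "r k = 1 - 1 / real (Suc k)" for k
  have r01: "0 \<le> r k" "r k < 1" for k by (auto simp: r_def)
  have rlim: "r \<longlonglongrightarrow> 1" unfolding r_def by real_asymp
  have iu: "(\<lambda>t. \<bar>u t\<bar>) integrable_on {0..1}"
    using u by (simp add: absolutely_integrable_on_def)
  have iu1: "u integrable_on {0..1}" using u by (simp add: absolutely_integrable_on_def)
  define I where "I k = integral {0..1} (\<lambda>t. u t * (abel_saw (r k) t - abel_saw (r k) (t - x)))" for k
  have term_int: "((\<lambda>t. u t * (sin (2*pi*real n*t) / real n - sin (2*pi*real n*(t-x)) / real n))
        has_integral d n) {0..1}" for n
  proof -
    have "((\<lambda>t. ((u t * sin (2*pi*real n*t)) * (1 - cos (2*pi*real n*x))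
              + (u t * cos (2*pi*real n*t)) * sin (2*pi*real n*x)) / real n)
        has_integral d n) {0..1}"
      unfolding d_def fourier_cos_def fourier_sin_def
      by (intro has_integral_divide has_integral_add has_integral_mult_left
          integrable_integral fourier_cos_integrable fourier_sin_integrable u)
    moreover have "((u t * sin (2*pi*real n*t)) * (1 - cos (2*pi*real n*x))
              + (u t * cos (2*pi*real n*t)) * sin (2*pi*real n*x)) / real n
            = u t * (sin (2*pi*real n*t) / real n - sin (2*pi*real n*(t-x)) / real n)" for t
      by (simp add: right_diff_distrib sin_diff diff_divide_distrib add_divide_distrib mult_ac)
         (simp add: algebra_simps)?
    ultimately show ?thesis by simp
  qed
  have abel: "(\<lambda>n. r k ^ n * d n) sums I k"
    and Iint: "(\<lambda>t. u t * (abel_saw (r k) t - abel_saw (r k) (t - x))) integrable_on {0..1}" for k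
  proof -
    let ?f = "\<lambda>n t. r k ^ n * (u t * (sin (2*pi*real n*t) / real n - sin (2*pi*real n*(t-x)) / real n))"
    have 1: "(?f n has_integral r k ^ n * d n) {0..1}" for n
      by (intro has_integral_mult_right term_int)
    have 2: "\<bar>?f n t\<bar> \<le> (2 * r k ^ n) * \<bar>u t\<bar>" for n t
    proof -
      have "\<bar>sin a / real n\<bar> \<le> 1" for a
      proof (cases "n = 0")
        case False
        have "\<bar>sin a\<bar> / real n \<le> 1 / 1" using False by (intro frac_le) auto
        then show ?thesis by simp
      qed auto
      from this[of "2*pi*real n*t"] this[of "2*pi*real n*(t-x)"]
      have "\<bar>sin (2*pi*real n*t) / real n - sin (2*pi*real n*(t-x)) / real n\<bar> \<le> 2"
        by linarith
      from mult_mono[OF order_refl[of "r k ^ n * \<bar>u t\<bar>"] this] r01[of k] show ?thesis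
        by (simp add: abs_mult mult_ac)
    qed
    have 3: "(\<lambda>n. ?f n t) sums (u t * (abel_saw (r k) t - abel_saw (r k) (t - x)))" for t
    proof -
      have "(\<lambda>n. u t * (r k ^ n * (sin (2*pi*real n*t) / real n)
                      - r k ^ n * (sin (2*pi*real n*(t-x)) / real n)))
            sums (u t * (abel_saw (r k) t - abel_saw (r k) (t - x)))"
        by (intro sums_mult sums_diff abel_saw_sums r01)
      then show ?thesis by (simp add: algebra_simps)
    qed
    have 4: "summable (\<lambda>n. 2 * r k ^ n)"
      using r01[of k] by (intro summable_mult summable_geometric) auto
    show "(\<lambda>n. r k ^ n * d n) sums I k"
      and "(\<lambda>t. u t * (abel_saw (r k) t - abel_saw (r k) (t - x))) integrable_on {0..1}"
      using has_integral_sums_dominated[OF 1 iu 2 4 _ 3] r01[of k] unfolding I_def by auto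
  qed
  have dsum: "summable (\<lambda>n. \<bar>d n\<bar>)"
  proof (rule summable_comparison_test'[OF summable_add[OF summable_mult[OF sS, of 2] sC]])
    show "norm \<bar>d n\<bar> \<le> 2 * (\<bar>fourier_sin u n\<bar> / real n) + \<bar>fourier_cos u n\<bar> / real n" for n
      unfolding d_def real_norm_def abs_idempotent by (rule abs_antiderivative_term_le)
  qed
  have "(\<lambda>k. \<Sum>n. r k ^ n * d n) \<longlonglongrightarrow> (\<Sum>n. d n)"
  proof -
    have "((\<lambda>k. r k ^ n * d n) \<longlonglongrightarrow> d n)" for n
    proof -
      have "((\<lambda>k. r k ^ n * d n) \<longlonglongrightarrow> 1 ^ n * d n)" by (intro tendsto_intros rlim)
      then show ?thesis by simp
    qed
    moreover have "\<bar>r k ^ n * d n\<bar> \<le> \<bar>d n\<bar>" for k n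
    proof -
      have "r k ^ n \<le> 1" using r01[of k] by (intro power_le_one) auto
      then have "r k ^ n * \<bar>d n\<bar> \<le> 1 * \<bar>d n\<bar>" by (intro mult_right_mono) auto
      then show ?thesis using r01[of k] by (simp add: abs_mult)
    qed
    ultimately show ?thesis
      using tannerys_theorem[of "\<lambda>n k. r k ^ n * d n" d sequentially "\<lambda>n. \<bar>d n\<bar>",
          OF _ always_eventually _ trivial_limit_sequentially] dsum
      by auto
  qed
  then have lim1: "I \<longlonglongrightarrow> (\<Sum>n. d n)"
    using abel by (simp add: sums_iff)
  have lim2: "I \<longlonglongrightarrow> pi * (integral {0..x} u - x * integral {0..1} u)"
  proof -
    \<comment> \<open>At the jumps the Abel means converge to midpoints instead of the values of the indicator
    function; these points form a null set, and all functions are set to 0 there.\<close>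
    define F where "F = {0, x, 1}"
    define f where "f k t = (if t \<in> F then 0 else u t * (abel_saw (r k) t - abel_saw (r k) (t - x)))" for k t
    define g where "g t = (if t \<in> F then 0 else u t * (pi * ((if t < x then 1 else 0) - x)))" for t
    have fin: "finite F" by (simp add: F_def)
    have f: "(f k has_integral I k) {0..1}" for k
      by (rule has_integral_spike_finite[OF fin _ integrable_integral[OF Iint[of k]], folded I_def])
         (auto simp: f_def)
    have 1: "f k integrable_on {0..1}" for k using f by blast
    have 2: "norm (f k t) \<le> pi * \<bar>u t\<bar>" if "t \<in> {0..1}" for k t
    proof -
      have "\<bar>abel_saw (r k) t - abel_saw (r k) (t - x)\<bar> \<le> pi"
        using abel_saw_bound[OF r01, of k t] abel_saw_bound[OF r01, of k "t - x"] by linarith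
      from mult_left_mono[OF this, of "\<bar>u t\<bar>"] show ?thesis
        by (auto simp: f_def abs_mult mult_ac)
    qed
    have 3: "(\<lambda>k. f k t) \<longlonglongrightarrow> g t" if "t \<in> {0..1}" for t
    proof (cases "t \<in> F")
      case False
      then show ?thesis unfolding f_def g_def if_not_P[OF False]
        by (intro tendsto_intros abel_saw_diff_tendsto rlim) (use x that in \<open>auto simp: F_def\<close>)
    qed (simp add: f_def g_def)
    have "(\<lambda>k. integral {0..1} (f k)) \<longlonglongrightarrow> integral {0..1} g"
      using dominated_convergence(2)[OF 1 integrable_on_mult_right[OF iu, of pi] 2 3] by simp
    then have "I \<longlonglongrightarrow> integral {0..1} g" unfolding integral_unique[OF f] .
    moreover have "(g has_integral pi * (integral {0..x} u - x * integral {0..1} u)) {0..1}"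
    proof -
      have "u integrable_on {0..x}"
        using iu1 x by (intro integrable_on_subinterval[OF iu1]) auto
      then have "(u has_integral integral {0..x} u) {0..x}" by blast
      then have "((\<lambda>t. if t \<in> {0..x} then u t else 0) has_integral integral {0..x} u) {0..1}"
        by (subst has_integral_restrict) (use x in auto)
      then have "((\<lambda>t. pi * ((if t \<in> {0..x} then u t else 0) - x * u t)) has_integral
               pi * (integral {0..x} u - x * integral {0..1} u)) {0..1}"
        using iu1 by (intro has_integral_mult_right has_integral_diff integrable_integral)
      then show ?thesis
        by (rule has_integral_spike_finite[OF fin, rotated])
           (auto simp: g_def F_def algebra_simps)
    qed
    ultimately show ?thesis by (simp add: integral_unique)
  qed
  have "(\<Sum>n. d n) = pi * (integral {0..x} u - x * integral {0..1} u)"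
    using lim1 lim2 by (rule LIMSEQ_unique)
  moreover have "summable d" using dsum by (rule summable_rabs_cancel)
  ultimately show ?thesis unfolding d_def[symmetric] by (simp add: sums_iff)
qed

text \<open>
  The function \<open>u\<close> may have singularities at 0 and 1, and the periodic extension of \<open>g\<close> may jump at
  the integers. Integration by parts turns \<open>\<integral> u g\<close> into an integral of \<open>g'\<close> against the antiderivative
  \<open>U\<close> of \<open>u\<close>; the series of \<open>U\<close> is dominated and can be integrated
  term by term, and integrating each term by parts again brings back the coefficients of \<open>g\<close>.
\<close>

lemma parseval_C1:
  fixes u g g' :: "real \<Rightarrow> real"
  assumes u: "u absolutely_integrable_on {0..1}" "continuous_on {0<..<1} u"
    and sC: "summable (\<lambda>n. \<bar>fourier_cos u n\<bar> / real n)"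
    and sS: "summable (\<lambda>n. \<bar>fourier_sin u n\<bar> / real n)"
    and g: "\<And>x. (g has_real_derivative g' x) (at x)" and g': "continuous_on {0..1} g'"
  shows "(\<lambda>n. fourier_cos u (Suc n) * fourier_cos g (Suc n) + fourier_sin u (Suc n) * fourier_sin g (Suc n))
     sums ((integral {0..1} (\<lambda>x. u x * g x) - integral {0..1} u * integral {0..1} g) / 2)"
proof -
  have iu: "u integrable_on {0..1}" using u by (simp add: absolutely_integrable_on_def)
  have gc: "continuous_on A g" for A
    by (rule DERIV_continuous_on[OF has_field_derivative_at_within[OF g]])
  define U where "U x = integral {0..x} u" for x
  have U0: "U 0 = 0" by (simp add: U_def)
  have Uc: "continuous_on {0..1} U"
    unfolding U_def by (rule indefinite_integral_continuous_1[OF iu])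
  have Ud: "(U has_real_derivative u x) (at x)" if "x \<in> {0<..<1}" for x
  proof -
    have "continuous (at x) u" using u(2) that by (simp add: continuous_on_eq_continuous_at)
    then have "(U has_vector_derivative u x) (at x within {0..1} - {})"
      unfolding U_def using that
      by (intro integral_has_vector_derivative_continuous_at iu) (auto intro: continuous_at_imp_continuous_at_within)
    moreover have "at x within {0..1} = at x" using that by (intro at_within_interior) auto
    ultimately show ?thesis by (simp add: has_real_derivative_iff_has_vector_derivative)
  qed
  have i_ug: "(\<lambda>x. u x * g x) integrable_on {0..1}"
    by (intro set_lebesgue_integral_eq_integral(1) abs_integrable_mult_continuous u gc)
  have "((\<lambda>x. u x * g x + U x * g' x) has_integral (U 1 * g 1 - U 0 * g 0)) {0..1}"
    by (rule fundamental_theorem_of_calculus_interior)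
       (auto intro!: continuous_intros Uc gc intro!: derivative_eq_intros Ud g
             simp flip: has_real_derivative_iff_has_vector_derivative)
  from has_integral_diff[OF this integrable_integral[OF i_ug]]
  have i_Ug': "((\<lambda>x. U x * g' x) has_integral (U 1 * g 1 - integral {0..1} (\<lambda>x. u x * g x))) {0..1}"
    by (simp add: U0)
  have i_g: "g integrable_on {0..1}" by (intro integrable_continuous_interval gc)
  have "((\<lambda>x. g x + x * g' x) has_integral (1 * g 1 - 0 * g 0)) {0..1}"
    by (rule fundamental_theorem_of_calculus_interior)
       (auto intro!: continuous_intros gc derivative_eq_intros g
             simp flip: has_real_derivative_iff_has_vector_derivative)
  from has_integral_diff[OF this integrable_integral[OF i_g]]
  have i_xg': "((\<lambda>x. x * g' x) has_integral (g 1 - integral {0..1} g)) {0..1}" by simp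
  have ag: "g absolutely_integrable_on {0..1}"
    by (intro absolutely_integrable_continuous_real gc)
  define y where "y n = (if n = 0 then 0 else
     - (2 * pi) * (fourier_cos u n * fourier_cos g n + fourier_sin u n * fourier_sin g n))" for n
  have gC: "((\<lambda>x. (1 - cos (2*pi*real n*x)) * g' x) has_integral - (2*pi*real n) * fourier_sin g n) {0..1}" for n
  proof -
    have "((\<lambda>x. (1 - cos (2*pi*real n*x)) * g' x + (2*pi*real n) * (g x * sin (2*pi*real n*x)))
        has_integral ((1 - cos (2*pi*real n*1)) * g 1 - (1 - cos (2*pi*real n*0)) * g 0)) {0..1}"
      by (rule fundamental_theorem_of_calculus_interior)
         (auto intro!: continuous_intros gc derivative_eq_intros g
             simp flip: has_real_derivative_iff_has_vector_derivative)
    note A = this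
    have B: "((\<lambda>x. (2*pi*real n) * (g x * sin (2*pi*real n*x)))
        has_integral (2*pi*real n) * fourier_sin g n) {0..1}"
      unfolding fourier_sin_def
      by (intro has_integral_mult_right integrable_integral fourier_sin_integrable ag)
    have c: "cos (2*pi*real n) = 1"
      using cos_int_2pin[of "int n"] by simp
    show ?thesis using has_integral_diff[OF A B] by (simp add: c)
  qed
  have gS: "((\<lambda>x. sin (2*pi*real n*x) * g' x) has_integral - (2*pi*real n) * fourier_cos g n) {0..1}" for n
  proof -
    have "((\<lambda>x. sin (2*pi*real n*x) * g' x + (2*pi*real n) * (g x * cos (2*pi*real n*x)))
        has_integral (sin (2*pi*real n*1) * g 1 - sin (2*pi*real n*0) * g 0)) {0..1}"
      by (rule fundamental_theorem_of_calculus_interior)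
         (auto intro!: continuous_intros gc derivative_eq_intros g
             simp flip: has_real_derivative_iff_has_vector_derivative)
    note A = this
    have B: "((\<lambda>x. (2*pi*real n) * (g x * cos (2*pi*real n*x)))
        has_integral (2*pi*real n) * fourier_cos g n) {0..1}"
      unfolding fourier_cos_def
      by (intro has_integral_mult_right integrable_integral fourier_cos_integrable ag)
    have c: "sin (2*pi*real n) = 0"
      using sin_int_2pin[of "int n"] by simp
    show ?thesis using has_integral_diff[OF A B] by (simp add: c)
  qed
  let ?f = "\<lambda>n x. (fourier_sin u n * (1 - cos (2 * pi * real n * x))
               + fourier_cos u n * sin (2 * pi * real n * x)) / real n * g' x"
  have 1: "(?f n has_integral y n) {0..1}" for n
  proof (cases "n = 0")
    case False
    have "((\<lambda>x. fourier_sin u n / real n * ((1 - cos (2 * pi * real n * x)) * g' x)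
          + fourier_cos u n / real n * (sin (2 * pi * real n * x) * g' x)) has_integral
          (fourier_sin u n / real n * (- (2*pi*real n) * fourier_sin g n)
          + fourier_cos u n / real n * (- (2*pi*real n) * fourier_cos g n))) {0..1}"
      by (intro has_integral_add has_integral_mult_right gS gC)
    then show ?thesis using False by (simp add: y_def field_simps)
  qed (simp add: y_def)
  define M where "M n = 2 * (\<bar>fourier_sin u n\<bar> / real n) + \<bar>fourier_cos u n\<bar> / real n" for n
  have 2: "\<bar>?f n x\<bar> \<le> M n * \<bar>g' x\<bar>" for n x
  proof -
    have "\<bar>(fourier_sin u n * (1 - cos (2 * pi * real n * x))
             + fourier_cos u n * sin (2 * pi * real n * x)) / real n\<bar> \<le> M n"
      unfolding M_def by (rule abs_antiderivative_term_le)
    then show ?thesis unfolding abs_mult[of _ "g' x"] by (intro mult_right_mono) auto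
  qed
  have 3: "summable M" unfolding M_def by (intro summable_add summable_mult sC sS)
  have 4: "(\<lambda>n. ?f n x) sums (pi * (U x - x * U 1) * g' x)" if "x \<in> {0..1}" for x
    unfolding U_def using that by (intro sums_mult2 fourier_antiderivative u sC sS) auto
  have 5: "(\<lambda>x. \<bar>g' x\<bar>) integrable_on {0..1}"
    by (intro integrable_continuous_interval continuous_intros g')
  have "y sums integral {0..1} (\<lambda>x. pi * (U x - x * U 1) * g' x)"
    by (rule has_integral_sums_dominated(2)[OF 1 5 2 3 _ 4]) (auto simp: M_def)
  moreover have "((\<lambda>x. pi * (U x * g' x - U 1 * (x * g' x))) has_integral
     pi * ((U 1 * g 1 - integral {0..1} (\<lambda>x. u x * g x)) - U 1 * (g 1 - integral {0..1} g))) {0..1}"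
    by (intro has_integral_mult_right has_integral_diff i_Ug' i_xg')
  then have "integral {0..1} (\<lambda>x. pi * (U x - x * U 1) * g' x)
     = - pi * (integral {0..1} (\<lambda>x. u x * g x) - U 1 * integral {0..1} g)"
    by (intro integral_unique) (simp add: algebra_simps)
  ultimately have "y sums (- pi * (integral {0..1} (\<lambda>x. u x * g x) - U 1 * integral {0..1} g))" by simp
  then have "(\<lambda>n. y (Suc n)) sums (- pi * (integral {0..1} (\<lambda>x. u x * g x) - U 1 * integral {0..1} g))"
    by (subst sums_Suc_iff) (simp add: y_def)
  then have "(\<lambda>n. y (Suc n) / (- (2*pi))) sums
     (- pi * (integral {0..1} (\<lambda>x. u x * g x) - U 1 * integral {0..1} g) / (- (2*pi)))"
    by (rule sums_divide)
  then show ?thesis by (simp add: y_def U_def add.commute)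
qed

section \<open>Euler's series for the logarithm of the Gamma function\<close>

lemma continuous_on_mult_ln: "continuous_on {0..} (\<lambda>x::real. x * ln x)"
proof (clarsimp simp: continuous_on_eq_continuous_within)
  fix x :: real assume "0 \<le> x"
  show "continuous (at x within {0..}) (\<lambda>x. x * ln x)"
  proof (cases "x = 0")
    case True
    have "((\<lambda>x::real. x * ln x) \<longlongrightarrow> 0) (at_right 0)" by real_asymp
    then show ?thesis using True by (simp add: continuous_within at_within_Ici_at_right)
  next
    case False
    then show ?thesis by (intro continuous_intros) auto
  qed
qed

lemma ln_absolutely_integrable: "(ln :: real \<Rightarrow> real) absolutely_integrable_on {0..1}"
proof -
  have "((\<lambda>x. - ln x) has_integral ((1 - 1 * ln 1) - (0 - 0 * ln (0::real)))) {0..1}"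
    by (rule fundamental_theorem_of_calculus_interior)
       (auto intro!: continuous_intros continuous_on_subset[OF continuous_on_mult_ln] derivative_eq_intros
             simp flip: has_real_derivative_iff_has_vector_derivative)
  then have "(\<lambda>x::real. - ln x) absolutely_integrable_on {0..1}"
    by (intro nonnegative_absolutely_integrable_1) (auto simp: has_integral_integrable ln_le_zero_iff le_less)
  from absolutely_integrable_scaleR_left[OF this, of "-1"] show ?thesis by simp
qed

text \<open>
  Apart from the singularity \<open>- ln x\<close> at 0, the partial sums of Euler's series for \<open>ln \<Gamma>\<close> are
  uniformly bounded on \<open>[0,1]\<close>. Above, concavity of \<open>ln\<close> gives \<open>ln (1 + x/k) \<ge> x (ln (k+1) - ln k)\<close>,
  which telescopes; below, \<open>ln (1 + x/k) \<le> x/k\<close> leaves a multiple of \<open>harm n - ln n\<close>.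
\<close>

lemma ln_Gamma_series_bounded:
  "\<exists>K. \<forall>N. \<forall>x\<in>{0..1}. \<bar>ln_Gamma_series x (Suc N) + ln x\<bar> \<le> (K::real)"
proof -
  have "Bseq (\<lambda>n. harm n - ln (real n))"
    using euler_mascheroni_LIMSEQ by (intro convergent_imp_Bseq) (auto simp: convergent_def)
  then obtain K where K: "\<And>n. \<bar>harm n - ln (real n)\<bar> \<le> K" by (auto simp: Bseq_def)
  have "\<bar>ln_Gamma_series x (Suc N) + ln x\<bar> \<le> K" if x: "0 \<le> x" "x \<le> 1" for x N
  proof -
    define n where "n = Suc N"
    have eq: "ln_Gamma_series x n + ln x = x * ln (real n) - (\<Sum>k=1..n. ln (x / real k + 1))"
      by (simp add: ln_Gamma_series_def)
    have "(\<Sum>k=1..n. ln (x / real k + 1)) \<le> (\<Sum>k=1..n. x / real k)"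
      using x by (intro sum_mono) (auto intro: order_trans[OF _ ln_add_one_self_le_self] simp: add.commute)
    also have "\<dots> = x * harm n"
      by (simp add: harm_def sum_distrib_left divide_inverse)
    finally have "ln_Gamma_series x n + ln x \<ge> x * (- (harm n - ln (real n)))"
      unfolding eq by (simp add: algebra_simps)
    moreover have "x * (- (harm n - ln (real n))) \<ge> - K"
    proof -
      have "x * \<bar>harm n - ln (real n)\<bar> \<le> 1 * K" using x K[of n] by (intro mult_mono) auto
      moreover have "x * (harm n - ln (real n)) \<le> x * \<bar>harm n - ln (real n)\<bar>"
        using x by (intro mult_left_mono) auto
      ultimately show ?thesis by linarith
    qed
    moreover have "x * ln (real n + 1) \<le> (\<Sum>k=1..n. ln (x / real k + 1))"
    proof -
      have "x * (ln (real (Suc k)) - ln (real k)) \<le> ln (x / real k + 1)" if k: "k \<ge> 1" for k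
      proof -
        have "(1 - x) * ln 1 + x * ln (1 + 1 / real k) \<le> ln ((1 - x) *\<^sub>R 1 + x *\<^sub>R (1 + 1 / real k))"
          using x k by (intro concave_onD[OF ln_concave]) (auto intro: add_pos_nonneg)
        moreover have "(1 - x) *\<^sub>R 1 + x *\<^sub>R (1 + 1 / real k) = x / real k + 1"
          by (simp add: algebra_simps)
        moreover have "ln (1 + 1 / real k) = ln (real (Suc k)) - ln (real k)"
        proof -
          have "1 + 1 / real k = real (Suc k) / real k" using k by (simp add: field_simps)
          then show ?thesis using k by (simp add: ln_div)
        qed
        ultimately show ?thesis by (simp only: ln_one mult_zero_right add_0)
      qed
      then have "(\<Sum>k=1..n. x * (ln (real (Suc k)) - ln (real k))) \<le> (\<Sum>k=1..n. ln (x / real k + 1))"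
        by (intro sum_mono) auto
      moreover have "(\<Sum>k=1..n. x * (ln (real (Suc k)) - ln (real k))) = x * ln (real n + 1)"
        unfolding sum_distrib_left[symmetric]
        by (subst sum_Suc_diff) (auto simp: add.commute)
      ultimately show ?thesis by simp
    qed
    moreover have "x * ln (real n) \<le> x * ln (real n + 1)"
      using x by (intro mult_left_mono) (auto simp: n_def)
    moreover have "0 \<le> K" using K[of n] by linarith
    ultimately show ?thesis unfolding eq n_def[symmetric] by linarith
  qed
  then show ?thesis by (intro exI[of _ K] allI ballI) auto
qed

text \<open>
  At \<open>x = 0\<close> both sides are 0, since \<open>ln 0 = 0\<close> and \<open>\<Gamma> 0 = 0\<close>. The point 0 can thus be kept in the
  domain of integration.
\<close>

lemma ln_Gamma_series_LIMSEQ: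
  fixes x :: real
  assumes "0 \<le> x"
  shows "(\<lambda>N. ln_Gamma_series x (Suc N)) \<longlonglongrightarrow> ln (Gamma x)"
proof (cases "x = 0")
  case False
  then show ?thesis using LIMSEQ_Suc[OF ln_Gamma_real_LIMSEQ[of x]] assms
    by (simp add: ln_Gamma_real_pos)
qed (simp add: ln_Gamma_series_def)

lemma ln_Gamma_series_integrable:
  "(\<lambda>x::real. ln_Gamma_series x (Suc N)) absolutely_integrable_on {0..1}"
proof -
  have "(\<lambda>x::real. x * ln (real (Suc N)) - (\<Sum>k=1..Suc N. ln (x / real k + 1))) absolutely_integrable_on {0..1}"
    by (intro absolutely_integrable_continuous_real continuous_intros ballI)
       (auto simp: add_nonneg_eq_0_iff divide_nonneg_nonneg)
  from set_integral_diff(1)[OF this ln_absolutely_integrable] show ?thesis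
    by (simp add: ln_Gamma_series_def algebra_simps del: sum.cl_ivl_Suc)
qed

lemma ln_Gamma_absolutely_integrable: "(\<lambda>x::real. ln (Gamma x)) absolutely_integrable_on {0..1}"
  and ln_Gamma_series_integral_LIMSEQ:
    "continuous_on {0..1} (\<phi> :: real \<Rightarrow> real) \<Longrightarrow>
      (\<lambda>N. integral {0..1} (\<lambda>x. ln_Gamma_series x (Suc N) * \<phi> x)) \<longlonglongrightarrow> integral {0..1} (\<lambda>x. ln (Gamma x) * \<phi> x)"
proof -
  obtain K where K: "\<And>N x. x \<in> {0..1} \<Longrightarrow> \<bar>ln_Gamma_series x (Suc N) + ln x\<bar> \<le> (K::real)"
    using ln_Gamma_series_bounded by blast
  have iln: "(\<lambda>x::real. \<bar>ln x\<bar>) integrable_on {0..1}"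
    using ln_absolutely_integrable by (simp add: absolutely_integrable_on_def)
  have h: "(\<lambda>x::real. K + \<bar>ln x\<bar>) integrable_on {0..1}"
    by (intro integrable_add iln) auto
  have le: "\<bar>ln_Gamma_series x (Suc N)\<bar> \<le> K + \<bar>ln x\<bar>" if "x \<in> {0..1}" for N x
    using K[OF that, of N] by linarith
  have lim: "(\<lambda>N. ln_Gamma_series x (Suc N)) \<longlonglongrightarrow> ln (Gamma x)" if "x \<in> {0..1}" for x :: real
    using ln_Gamma_series_LIMSEQ that by auto
  have i: "(\<lambda>x::real. ln_Gamma_series x (Suc N)) integrable_on {0..1}" for N
    using ln_Gamma_series_integrable by (simp add: absolutely_integrable_on_def)
  have "(\<lambda>x. ln (Gamma x)) integrable_on {0..1::real}"
    by (rule dominated_convergence(1)[OF i h _ lim]) (use le in auto)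
  moreover have "norm (ln (Gamma x)) \<le> K + \<bar>ln x\<bar>" if "x \<in> {0..1}" for x
    using le that by (intro Lim_bounded[OF tendsto_norm[OF lim[OF that]], of 0]) auto
  ultimately show "(\<lambda>x::real. ln (Gamma x)) absolutely_integrable_on {0..1}"
    by (intro absolutely_integrable_integrable_bound[OF _ _ h]) auto
  assume c: "continuous_on {0..1} (\<phi> :: real \<Rightarrow> real)"
  have "bounded (\<phi> ` {0..1})" using c by (intro compact_imp_bounded compact_continuous_image) auto
  then obtain B where B: "\<And>x. x \<in> {0..1} \<Longrightarrow> \<bar>\<phi> x\<bar> \<le> B" by (auto simp: bounded_iff simp del: atLeastAtMost_iff)
  show "(\<lambda>N. integral {0..1} (\<lambda>x. ln_Gamma_series x (Suc N) * \<phi> x)) \<longlonglongrightarrow> integral {0..1} (\<lambda>x. ln (Gamma x) * \<phi> x)"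
  proof (rule dominated_convergence(2))
    show "(\<lambda>x. ln_Gamma_series x (Suc N) * \<phi> x) integrable_on {0..1}" for N
      by (intro set_lebesgue_integral_eq_integral(1) abs_integrable_mult_continuous
            ln_Gamma_series_integrable c)
    show "(\<lambda>x. (K + \<bar>ln x\<bar>) * B) integrable_on {0..1}"
      using h by (rule integrable_on_mult_left)
    show "norm (ln_Gamma_series x (Suc N) * \<phi> x) \<le> (K + \<bar>ln x\<bar>) * B" if "x \<in> {0..1}" for N x
      unfolding norm_mult using le[OF that, of N] B[OF that] by (intro mult_mono) auto
    show "(\<lambda>N. ln_Gamma_series x (Suc N) * \<phi> x) \<longlonglongrightarrow> ln (Gamma x) * \<phi> x" if "x \<in> {0..1}" for x
      by (intro tendsto_intros lim that)
  qed
qed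

lemma continuous_on_ln_Gamma_real: "A \<subseteq> {0<..} \<Longrightarrow> continuous_on A (\<lambda>x::real. ln (Gamma x))"
  by (intro continuous_intros) (auto simp: Gamma_eq_zero_iff elim!: nonpos_Ints_cases)

lemma Gamma_reflection_real:
  fixes x :: real
  shows "Gamma x * Gamma (1 - x) = pi / sin (pi * x)"
proof -
  have "complex_of_real (Gamma x * Gamma (1 - x)) = of_real (pi / sin (pi * x))"
    using Gamma_reflection_complex[of "of_real x"] Gamma_complex_of_real[of x]
      Gamma_complex_of_real[of "1 - x"] sin_of_real[of "pi * x", where 'a = complex]
    by simp
  then show ?thesis by (simp only: of_real_eq_iff)
qed

lemma Gamma_duplication_real:
  fixes x :: real
  assumes "x > 0"
  shows "Gamma x * Gamma (x + 1/2) = exp ((1 - 2 * x) * ln 2) * sqrt pi * Gamma (2 * x)"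
proof -
  have *: "complex_of_real a \<notin> \<int>\<^sub>\<le>\<^sub>0" if "a > 0" for a
    using that by (auto elim!: nonpos_Ints_cases simp: complex_eq_iff)
  have "complex_of_real (Gamma x * Gamma (x + 1/2)) = of_real (exp ((1 - 2 * x) * ln 2) * sqrt pi * Gamma (2 * x))"
    using Gamma_legendre_duplication[of "of_real x"] *[of x] *[of "x + 1/2"] assms
    by (simp flip: Gamma_complex_of_real exp_of_real)
  then show ?thesis by (simp only: of_real_eq_iff)
qed

section \<open>Mean value and cosine coefficients of the logarithm of the Gamma function\<close>

text \<open>
  Raabe's integral. Integrating the logarithm of the duplication formula over \<open>[0, 1/2]\<close> expresses
  the integral \<open>I\<close> through \<open>I/2\<close>: the two factors on the left contribute the two halves of \<open>I\<close>, the
  factor \<open>\<Gamma>(2x)\<close> contributes \<open>I/2\<close>.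
\<close>

lemma integral_ln_Gamma: "integral {0..1} (\<lambda>x::real. ln (Gamma x)) = ln (2 * pi) / 2"
proof -
  let ?L = "\<lambda>x::real. ln (Gamma x)"
  define I where "I = integral {0..1} ?L"
  have iL: "?L integrable_on {0..1}"
    using ln_Gamma_absolutely_integrable by (simp add: absolutely_integrable_on_def)
  have I: "(?L has_integral I) {0..1}" unfolding I_def by (rule integrable_integral[OF iL])
  have A: "(?L has_integral integral {0..1/2} ?L) {0..1/2}"
    by (intro integrable_integral integrable_on_subinterval[OF iL]) auto
  have B: "(?L has_integral integral {1/2..1} ?L) {1/2..1}"
    by (intro integrable_integral integrable_on_subinterval[OF iL]) auto
  have AB: "integral {0..1/2} ?L + integral {1/2..1} ?L = I"
    unfolding I_def by (rule Henstock_Kurzweil_Integration.integral_combine) (use iL in auto)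
  have "((?L \<circ> (+) (1/2)) has_integral integral {1/2..1} ?L) {0..1/2}"
    unfolding has_integral_shift_Icc_real using B by simp
  from has_integral_add[OF A this]
  have lhs: "((\<lambda>x. ?L x + ?L (x + 1/2)) has_integral I) {0..1/2}"
    by (simp add: AB o_def add.commute)
  have "((\<lambda>x. (1 - 2 * x) * ln 2 + ln pi / 2) has_integral
      (((1/2) - (1/2)\<^sup>2) * ln 2 + (1/2) * (ln pi / 2) - ((0 - 0\<^sup>2) * ln 2 + 0 * (ln pi / 2)))) {0..1/2}"
    by (rule fundamental_theorem_of_calculus_interior)
       (auto intro!: continuous_intros derivative_eq_intros
             simp flip: has_real_derivative_iff_has_vector_derivative)
  moreover have "((\<lambda>x. ?L (2 * x)) has_integral I / 2) {0..1/2}"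
    using has_integral_affinity'[of ?L I 0 1 2 0] I by simp
  ultimately have "((\<lambda>x. (1 - 2 * x) * ln 2 + ln pi / 2 + ?L (2 * x)) has_integral
      (((1/2) - (1/2)\<^sup>2) * ln 2 + (1/2) * (ln pi / 2) - ((0 - 0\<^sup>2) * ln 2 + 0 * (ln pi / 2)) + I / 2)) {0..1/2}"
    by (rule has_integral_add)
  then have "((\<lambda>x. ?L x + ?L (x + 1/2)) has_integral
      (((1/2) - (1/2)\<^sup>2) * ln 2 + (1/2) * (ln pi / 2) - ((0 - 0\<^sup>2) * ln 2 + 0 * (ln pi / 2)) + I / 2)) {0..1/2}"
  proof (rule has_integral_spike_finite[of "{0}", rotated 2])
    fix x :: real assume "x \<in> {0..1/2} - {0}"
    then have x: "x > 0" by auto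
    then have p: "Gamma x > 0" "Gamma (x + 1/2) > 0" "Gamma (2 * x) > 0"
      by (auto intro!: Gamma_real_pos)
    have "?L x + ?L (x + 1/2) = ln (Gamma x * Gamma (x + 1/2))"
      using p by (simp add: ln_mult_pos)
    also have "\<dots> = ln (exp ((1 - 2 * x) * ln 2) * sqrt pi * Gamma (2 * x))"
      by (simp only: Gamma_duplication_real[OF x])
    also have "\<dots> = (1 - 2 * x) * ln 2 + ln pi / 2 + ?L (2 * x)"
      using p by (simp add: ln_mult_pos ln_sqrt)
    finally show "?L x + ?L (x + 1/2) = (1 - 2 * x) * ln 2 + ln pi / 2 + ?L (2 * x)" .
  qed auto
  from has_integral_unique[OF lhs this] have "I = (ln 2 + ln pi) / 2"
    by (simp add: power2_eq_square field_simps)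
  then show ?thesis by (simp add: I_def ln_mult_pos)
qed

text \<open>
  By the product-to-sum formula the terms become differences of sines and telescope; in the same way
  the companion sum of sines telescopes to a difference of cosines.
\<close>

lemma sin_times_sum_cos_odd:
  fixes a :: real
  shows "sin a * (\<Sum>k<n. 2 * cos (real (2 * k + 1) * a)) = sin (2 * real n * a)"
proof (induction n)
  case (Suc n)
  have "sin (real (2 * n + 1) * a + a) - sin (real (2 * n + 1) * a - a) = sin a * (2 * cos (real (2 * n + 1) * a))"
    by (simp only: sin_add sin_diff) (simp only: algebra_simps)
  moreover have "real (2 * n + 1) * a + a = 2 * real (Suc n) * a" "real (2 * n + 1) * a - a = 2 * real n * a"
    by (simp_all add: algebra_simps)
  ultimately show ?case using Suc unfolding sum.lessThan_Suc distrib_left by simp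
qed simp

lemma sin_times_sum_sin_odd:
  fixes a :: real
  shows "sin a * (\<Sum>k<n. 2 * sin (real (2 * k + 1) * a)) = 1 - cos (2 * real n * a)"
proof (induction n)
  case (Suc n)
  have "cos (real (2 * n + 1) * a - a) - cos (real (2 * n + 1) * a + a) = sin a * (2 * sin (real (2 * n + 1) * a))"
    by (simp only: cos_add cos_diff) (simp only: algebra_simps)
  moreover have "real (2 * n + 1) * a + a = 2 * real (Suc n) * a" "real (2 * n + 1) * a - a = 2 * real n * a"
    by (simp_all add: algebra_simps)
  ultimately show ?case using Suc unfolding sum.lessThan_Suc distrib_left by simp
qed simp

lemma has_integral_cos_2pi:
  "((\<lambda>x. cos (2 * pi * real m * x)) has_integral (if m = 0 then 1 else 0)) {0..1}"
proof (cases "m = 0")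
  case True
  then show ?thesis using has_integral_const_real[of "1::real" 0 1] by simp
next
  case False
  have "((\<lambda>x. cos (2 * pi * real m * x)) has_integral
     (sin (2 * pi * real m * 1) / (2 * pi * real m) - sin (2 * pi * real m * 0) / (2 * pi * real m))) {0..1}"
    using False
    by (intro fundamental_theorem_of_calculus_interior)
       (auto intro!: continuous_intros derivative_eq_intros
             simp flip: has_real_derivative_iff_has_vector_derivative)
  moreover have "sin (2 * pi * real m) = 0" using sin_int_2pin[of "int m"] by simp
  ultimately show ?thesis using False by simp
qed

text \<open>
  Integration by parts against \<open>sin (2\<pi>nx)\<close>. The factor \<open>sin (\<pi>x)\<close> contained in \<open>sin (2\<pi>nx)\<close> removes the
  logarithmic singularities of the boundary terms and turns \<open>cot (\<pi>x) sin (2\<pi>nx)\<close> into the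
  trigonometric polynomial \<open>1 + 2 cos (2\<pi>x) + \<dots> + cos (2\<pi>nx)\<close> of integral 1.
\<close>

lemma has_integral_ln_sin_cos:
  assumes n: "n > 0"
  shows "((\<lambda>x. ln (sin (pi * x)) * cos (2 * pi * real n * x)) has_integral - (1 / (2 * real n))) {0..1}"
proof -
  define W where "W x = (\<Sum>k<n. 2 * cos (real (2 * k + 1) * (pi * x)))" for x
  define F where "F x = sin (pi * x) * ln (sin (pi * x)) * W x" for x
  have W: "sin (pi * x) * W x = sin (2 * pi * real n * x)" for x
    unfolding W_def sin_times_sum_cos_odd by (simp add: mult_ac)
  have F: "F = (\<lambda>x. ln (sin (pi * x)) * sin (2 * pi * real n * x))"
    unfolding F_def W[symmetric] by (simp add: mult_ac)
  have sin_nonneg: "sin (pi * x) \<ge> 0" if "x \<in> {0..1}" for x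
    using that by (intro sin_ge_zero) auto
  have Fc: "continuous_on {0..1} F"
    unfolding F_def W_def
    by (intro continuous_on_mult[OF continuous_on_compose2[OF continuous_on_mult_ln, of _ "\<lambda>x. sin (pi * x)"]]
          continuous_intros) (use sin_nonneg in auto)
  have "((\<lambda>x. (2 * pi * real n) * (ln (sin (pi * x)) * cos (2 * pi * real n * x)) + pi * (cos (pi * x) * W x))
       has_integral (F 1 - F 0)) {0..1}"
  proof (rule fundamental_theorem_of_calculus_interior[OF _ Fc])
    fix x :: real assume x: "x \<in> {0<..<1}"
    have s: "sin (pi * x) > 0" using x by (intro sin_gt_zero) auto
    have "(F has_real_derivative
       (2 * pi * real n) * (ln (sin (pi * x)) * cos (2 * pi * real n * x))
        + (pi * cos (pi * x) / sin (pi * x)) * sin (2 * pi * real n * x)) (at x)"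
      unfolding F using s by (auto intro!: derivative_eq_intros)
    moreover have "(pi * cos (pi * x) / sin (pi * x)) * sin (2 * pi * real n * x) = pi * (cos (pi * x) * W x)"
      using s unfolding W[symmetric] by simp
    ultimately show "(F has_vector_derivative
       (2 * pi * real n) * (ln (sin (pi * x)) * cos (2 * pi * real n * x)) + pi * (cos (pi * x) * W x)) (at x)"
      by (simp add: has_real_derivative_iff_has_vector_derivative)
  qed auto
  moreover have "F 1 = 0" "F 0 = 0" by (auto simp: F_def)
  ultimately have 1: "((\<lambda>x. (2 * pi * real n) * (ln (sin (pi * x)) * cos (2 * pi * real n * x)) + pi * (cos (pi * x) * W x))
       has_integral 0) {0..1}" by simp
  have "((\<lambda>x. \<Sum>k<n. cos (2 * pi * real (Suc k) * x) + cos (2 * pi * real k * x)) has_integral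
        (\<Sum>k<n. (if Suc k = 0 then 1 else 0) + (if k = 0 then 1 else 0))) {0..1}"
    by (intro has_integral_sum has_integral_add has_integral_cos_2pi) auto
  moreover have "(\<Sum>k<n. cos (2 * pi * real (Suc k) * x) + cos (2 * pi * real k * x)) = cos (pi * x) * W x" for x
    unfolding W_def sum_distrib_left
  proof (rule sum.cong[OF refl])
    fix k
    let ?a = "pi * x" and ?b = "real (2 * k + 1) * (pi * x)"
    have "cos (?b + ?a) + cos (?b - ?a) = cos ?a * (2 * cos ?b)"
      by (simp only: cos_add cos_diff) (simp only: algebra_simps)
    moreover have "?b + ?a = 2 * pi * real (Suc k) * x" "?b - ?a = 2 * pi * real k * x"
      by (simp_all add: algebra_simps)
    ultimately show "cos (2 * pi * real (Suc k) * x) + cos (2 * pi * real k * x) = cos ?a * (2 * cos ?b)"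
      by (simp only:)
  qed
  moreover have "(\<Sum>k<n. (if Suc k = 0 then 1 else 0) + (if k = 0 then 1 else 0)) = (1::real)"
    using n by simp
  ultimately have "((\<lambda>x. cos (pi * x) * W x) has_integral 1) {0..1}" by simp
  from has_integral_diff[OF 1 has_integral_mult_right[OF this, of pi]]
  have "((\<lambda>x. (2 * pi * real n) * (ln (sin (pi * x)) * cos (2 * pi * real n * x))) has_integral - pi) {0..1}"
    by simp
  from has_integral_mult_right[OF this, of "1 / (2 * pi * real n)"] n show ?thesis by simp
qed

text \<open>
  The cosine is even about \<open>1/2\<close>, so it only sees the even part of \<open>ln \<Gamma>\<close>, which the reflection
  formula reduces to \<open>ln (sin (\<pi>x))\<close>.
\<close>

lemma fourier_cos_ln_Gamma:
  assumes n: "n > 0"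
  shows "fourier_cos (\<lambda>x. ln (Gamma x)) n = 1 / (4 * real n)"
proof -
  define f where "f x = ln (Gamma x) * cos (2 * pi * real n * x)" for x :: real
  define C where "C = fourier_cos (\<lambda>x. ln (Gamma x)) n"
  have f: "(f has_integral C) {0..1}"
    unfolding f_def C_def fourier_cos_def
    by (intro integrable_integral fourier_cos_integrable ln_Gamma_absolutely_integrable)
  then have "((\<lambda>x. f (- x)) has_integral C) {-1..-0}" by (subst has_integral_reflect_real)
  then have "(((\<lambda>x. f (- x)) \<circ> (+) (-1)) has_integral C) {0..1}"
    unfolding has_integral_shift_Icc_real by simp
  then have "((\<lambda>x. f (1 - x)) has_integral C) {0..1}" by (simp add: o_def)
  from has_integral_add[OF f this] have 1: "((\<lambda>x. f x + f (1 - x)) has_integral 2 * C) {0..1}" by simp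
  have "((\<lambda>x. ln pi * cos (2 * pi * real n * x) - ln (sin (pi * x)) * cos (2 * pi * real n * x)) has_integral
      ln pi * (if n = 0 then 1 else 0) - - (1 / (2 * real n))) {0..1}"
    by (intro has_integral_diff has_integral_mult_right has_integral_cos_2pi has_integral_ln_sin_cos n)
  then have "((\<lambda>x. f x + f (1 - x)) has_integral
      ln pi * (if n = 0 then 1 else 0) - - (1 / (2 * real n))) {0..1}"
  proof (rule has_integral_spike_finite[of "{0,1}", rotated 2])
    fix x :: real assume "x \<in> {0..1} - {0,1}"
    then have x: "0 < x" "x < 1" by auto
    have s: "sin (pi * x) > 0" using x by (intro sin_gt_zero) auto
    have p: "Gamma x > 0" "Gamma (1 - x) > 0" using x by (auto intro!: Gamma_real_pos)
    have "ln (Gamma x) + ln (Gamma (1 - x)) = ln (Gamma x * Gamma (1 - x))"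
      using p by (simp add: ln_mult_pos)
    also have "\<dots> = ln pi - ln (sin (pi * x))"
      using s unfolding Gamma_reflection_real by (simp add: ln_div)
    finally have L: "ln (Gamma x) + ln (Gamma (1 - x)) = ln pi - ln (sin (pi * x))" .
    have "cos (2 * pi * real n * (1 - x)) = cos (2 * pi * real n - 2 * pi * real n * x)"
      by (simp add: algebra_simps)
    also have "\<dots> = cos (2 * pi * real n * x)"
      using cos_int_2pin[of "int n"] sin_int_2pin[of "int n"] by (simp add: cos_diff)
    finally have c: "cos (2 * pi * real n * (1 - x)) = cos (2 * pi * real n * x)" .
    show "f x + f (1 - x) = ln pi * cos (2 * pi * real n * x) - ln (sin (pi * x)) * cos (2 * pi * real n * x)"
      unfolding f_def c by (simp flip: L distrib_right left_diff_distrib)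
  qed auto
  from has_integral_unique[OF 1 this] n show ?thesis by (simp add: C_def)
qed

section \<open>The cosine integral and the sine coefficients\<close>

definition Cin :: "real \<Rightarrow> real" where
  "Cin t = integral {0..t} (\<lambda>u. (1 - cos u) / u)"

lemma isCont_one_minus_cos_div: "isCont (\<lambda>u::real. (1 - cos u) / u) u"
proof (cases "u = 0")
  case True
  have "((\<lambda>u::real. (1 - cos u) / u) \<longlongrightarrow> 0) (at 0)" by real_asymp
  then show ?thesis using True by (simp add: isCont_def)
qed (auto intro!: continuous_intros)

lemma continuous_on_one_minus_cos_div: "continuous_on A (\<lambda>u::real. (1 - cos u) / u)"
  by (intro continuous_at_imp_continuous_on ballI isCont_one_minus_cos_div)

lemma Cin_0 [simp]: "Cin 0 = 0"
  by (simp add: Cin_def)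

lemma Cin_derivative:
  assumes "t > 0"
  shows "(Cin has_real_derivative (1 - cos t) / t) (at t)"
proof -
  have "(Cin has_real_derivative (1 - cos t) / t) (at t within {0..t + 1})"
    unfolding Cin_def
    by (rule integral_has_real_derivative) (use assms in \<open>auto intro: continuous_on_one_minus_cos_div\<close>)
  moreover have "at t within {0..t + 1} = at t" using assms by (intro at_within_interior) auto
  ultimately show ?thesis by simp
qed

lemma continuous_on_Cin: "continuous_on {0..b} Cin"
  unfolding Cin_def
  by (intro indefinite_integral_continuous_1 integrable_continuous_interval continuous_on_one_minus_cos_div)

text \<open>
  The quotient is \<open>2 (sin x + sin 3x + \<dots> + sin (2M-1)x)\<close>, and each of these sines has integral
  \<open>1/(2k+1)\<close> over a quarter period. At \<open>x = 0\<close> the quotient \<open>0/0 = 0\<close> agrees with the sum.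
\<close>

lemma has_integral_one_minus_cos_div_sin:
  "((\<lambda>x. (1 - cos (2 * real M * x)) / sin x) has_integral (2 * harm (2 * M) - harm M)) {0..pi/2}"
proof -
  have 1: "((\<lambda>x. 2 * sin (real (2 * k + 1) * x)) has_integral 2 / real (2 * k + 1)) {0..pi/2}" for k
  proof -
    have "((\<lambda>x. 2 * sin (real (2 * k + 1) * x)) has_integral
       (- (2 / real (2 * k + 1)) * cos (real (2 * k + 1) * (pi/2))
        - (- (2 / real (2 * k + 1)) * cos (real (2 * k + 1) * 0)))) {0..pi/2}"
      by (rule fundamental_theorem_of_calculus_interior)
         (auto intro!: continuous_intros derivative_eq_intros simp del: of_nat_add of_nat_mult
             simp flip: has_real_derivative_iff_has_vector_derivative)
    moreover have "real (2 * k + 1) * (pi/2) = real k * pi + pi / 2" by (simp add: algebra_simps)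
    then have "cos (real (2 * k + 1) * (pi/2)) = 0" by (simp only: cos_add) simp
    ultimately show ?thesis by simp
  qed
  have "((\<lambda>x. \<Sum>k<M. 2 * sin (real (2 * k + 1) * x)) has_integral (\<Sum>k<M. 2 / real (2 * k + 1))) {0..pi/2}"
    by (intro has_integral_sum 1) auto
  then have "((\<lambda>x. (1 - cos (2 * real M * x)) / sin x) has_integral (\<Sum>k<M. 2 / real (2 * k + 1))) {0..pi/2}"
  proof (rule has_integral_eq[rotated])
    fix x :: real assume x: "x \<in> {0..pi/2}"
    show "(\<Sum>k<M. 2 * sin (real (2 * k + 1) * x)) = (1 - cos (2 * real M * x)) / sin x"
    proof (cases "x = 0")
      case False
      then have "sin x > 0" using x by (intro sin_gt_zero) auto
      then show ?thesis unfolding sin_times_sum_sin_odd[symmetric] by simp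
    qed simp
  qed
  moreover have "(\<Sum>k<M. 2 / real (2 * k + 1)) = 2 * harm (2 * M) - harm M"
  proof (induction M)
    case (Suc M)
    have "(harm (2 * Suc M) :: real) = harm (Suc (Suc (2 * M)))" by simp
    also have "\<dots> = harm (2 * M) + inverse (real (2 * M + 1)) + inverse (2 * real (Suc M))"
      unfolding harm_Suc by simp
    finally have "(harm (2 * Suc M) :: real) = harm (2 * M) + inverse (real (2 * M + 1)) + inverse (2 * real (Suc M))" .
    moreover have "2 * inverse (2 * real (Suc M)) = inverse (real (Suc M))" by (simp del: of_nat_Suc)
    moreover have "(harm (Suc M) :: real) = harm M + inverse (real (Suc M))" by (rule harm_Suc)
    ultimately show ?case using Suc unfolding sum.lessThan_Suc divide_inverse by linarith
  qed (simp add: harm_def)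
  ultimately show ?thesis by (simp only:)
qed

lemma has_integral_Cin:
  assumes "M > 0"
  shows "((\<lambda>x. (1 - cos (2 * real M * x)) / x) has_integral Cin (pi * real M)) {0..pi/2}"
proof -
  have "((\<lambda>x. (1 - cos (2 * real M * x)) / x) has_integral Cin (2 * real M * (pi/2)) - Cin (2 * real M * 0)) {0..pi/2}"
  proof (rule fundamental_theorem_of_calculus_interior)
    have "(\<lambda>x. 2 * real M * x) ` {0..pi/2} \<subseteq> {0..2 * real M * (pi/2)}"
    proof (rule image_subsetI)
      fix x assume x: "x \<in> {0..pi/2}"
      have "2 * real M * x \<le> 2 * real M * (pi/2)" using x by (intro mult_left_mono) auto
      then show "2 * real M * x \<in> {0..2 * real M * (pi/2)}" using x by simp
    qed
    then show "continuous_on {0..pi/2} (\<lambda>x. Cin (2 * real M * x))"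
      by (intro continuous_on_compose2[OF continuous_on_Cin] continuous_intros)
    fix x assume x: "x \<in> {0<..<pi/2}"
    have "((\<lambda>x. Cin (2 * real M * x)) has_real_derivative
       (1 - cos (2 * real M * x)) / (2 * real M * x) * (2 * real M)) (at x)"
      using x assms by (intro DERIV_chain2[OF Cin_derivative] derivative_eq_intros) auto
    then show "((\<lambda>x. Cin (2 * real M * x)) has_vector_derivative (1 - cos (2 * real M * x)) / x) (at x)"
      using assms by (simp add: has_real_derivative_iff_has_vector_derivative)
  qed auto
  then show ?thesis by (simp add: mult.commute)
qed

lemma continuous_on_inverse_minus_csc: "continuous_on {0..pi/2} (\<lambda>x::real. 1 / x - 1 / sin x)"
proof (rule continuous_at_imp_continuous_on, rule ballI)
  fix x assume x: "x \<in> {0..pi/2}"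
  show "isCont (\<lambda>x::real. 1 / x - 1 / sin x) x"
  proof (cases "x = 0")
    case True
    have "((\<lambda>x::real. 1 / x - 1 / sin x) \<longlongrightarrow> 0) (at 0)" by real_asymp
    then show ?thesis using True by (simp add: isCont_def)
  next
    case False
    then have "sin x > 0" using x by (intro sin_gt_zero) auto
    then show ?thesis using False by (intro continuous_intros) auto
  qed
qed

text \<open>
  The antiderivative is \<open>ln (x / tan (x/2))\<close>, with limit \<open>ln 2\<close> at 0 and value \<open>ln (\<pi>/2)\<close> at \<open>\<pi>/2\<close>.
\<close>

lemma has_integral_inverse_minus_csc:
  "((\<lambda>x. 1 / x - 1 / sin x) has_integral ln (pi / 4)) {0..pi/2}"
proof -
  define H where "H x = (if x = 0 then ln 2 else ln (x / tan (x / 2)))" for x :: real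
  have Hd: "(H has_real_derivative (1 / x - 1 / sin x)) (at x)" if "0 < x" "x \<le> pi/2" for x
  proof -
    have s: "sin (x/2) > 0" "cos (x/2) > 0" using that by (auto intro!: sin_gt_zero cos_gt_zero)
    have "((\<lambda>x. ln x - ln (sin (x/2)) + ln (cos (x/2))) has_real_derivative
       (1 / x - (cos (x/2) / 2) / sin (x/2) - (sin (x/2) / 2) / cos (x/2))) (at x)"
      using that s by (auto intro!: derivative_eq_intros)
    moreover have "(cos (x/2) / 2) / sin (x/2) + (sin (x/2) / 2) / cos (x/2) = 1 / sin x"
    proof -
      have "sin x = 2 * sin (x/2) * cos (x/2)" using sin_double[of "x/2"] by simp
      moreover have "(cos (x/2) / 2) / sin (x/2) + (sin (x/2) / 2) / cos (x/2)
          = ((sin (x/2))\<^sup>2 + (cos (x/2))\<^sup>2) / (2 * sin (x/2) * cos (x/2))"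
        using s by (simp add: field_simps power2_eq_square)
      ultimately show ?thesis by simp
    qed
    ultimately have "((\<lambda>x. ln x - ln (sin (x/2)) + ln (cos (x/2))) has_real_derivative (1 / x - 1 / sin x)) (at x)"
      by (simp add: diff_diff_eq)
    moreover have "eventually (\<lambda>y. H y = ln y - ln (sin (y/2)) + ln (cos (y/2))) (nhds x)"
    proof -
      have "eventually (\<lambda>y. y \<in> {0<..<pi}) (nhds x)"
        using that by (intro eventually_nhds_in_open) auto
      then show ?thesis
      proof eventually_elim
        case (elim y)
        then have "sin (y/2) > 0" "cos (y/2) > 0" by (auto intro!: sin_gt_zero cos_gt_zero)
        then show ?case using elim by (simp add: H_def tan_def ln_div ln_mult_pos)
      qed
    qed
    ultimately show ?thesis by (subst DERIV_cong_ev[OF refl _ refl]) auto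
  qed
  have "((\<lambda>x. 1 / x - 1 / sin x) has_integral (H (pi/2) - H 0)) {0..pi/2}"
  proof (rule fundamental_theorem_of_calculus_interior)
    show "continuous_on {0..pi/2} H"
      unfolding continuous_on_eq_continuous_within
    proof
      fix x assume x: "x \<in> {0..pi/2}"
      show "continuous (at x within {0..pi/2}) H"
      proof (cases "x = 0")
        case True
        have "((\<lambda>x::real. ln (x / tan (x / 2))) \<longlongrightarrow> ln 2) (at_right 0)" by real_asymp
        then have "(H \<longlongrightarrow> ln 2) (at_right 0)"
          by (rule Lim_transform_eventually) (auto simp: H_def eventually_at_filter)
        then have "(H \<longlongrightarrow> ln 2) (at 0 within {0..pi/2})"
          by (simp add: at_within_Icc_at_right)
        then show ?thesis using True by (simp add: continuous_within H_def)
      next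
        case False
        then have "isCont H x" using x Hd[of x] by (intro DERIV_isCont) auto
        then show ?thesis by (rule continuous_at_imp_continuous_at_within)
      qed
    qed
  next
    show "(H has_vector_derivative 1 / x - 1 / sin x) (at x)" if "x \<in> {0<..<pi/2}" for x
      using Hd[of x] that by (simp add: has_real_derivative_iff_has_vector_derivative)
  qed auto
  moreover have "H (pi/2) - H 0 = ln (pi / 4)"
  proof -
    have "H (pi/2) = ln (pi / 2)" using tan_45 by (simp add: H_def)
    moreover have "ln (pi / 2) - ln 2 = ln (pi / 2 / 2)" by (rule ln_divide_pos[symmetric]) auto
    ultimately show ?thesis by (simp add: H_def)
  qed
  ultimately show ?thesis by simp
qed

text \<open>
  A case of the Riemann-Lebesgue lemma: \<open>1/x - 1/sin x\<close> is continuously differentiable up to 0, with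
  derivative \<open>-1/6\<close> there, so one integration by parts gives the bound \<open>O(1/M)\<close>.
\<close>

lemma integral_inverse_minus_csc_cos_tendsto_0:
  "(\<lambda>M. integral {0..pi/2} (\<lambda>x. (1 / x - 1 / sin x) * cos (2 * real M * x))) \<longlonglongrightarrow> 0"
proof -
  define h where "h x = 1 / x - 1 / sin x" for x :: real
  define h' where "h' x = (if x = 0 then - 1 / 6 else cos x / (sin x)\<^sup>2 - 1 / x\<^sup>2)" for x :: real
  have h'c: "continuous_on {0..pi/2} h'"
  proof (rule continuous_at_imp_continuous_on, rule ballI)
    fix x assume x: "x \<in> {0..pi/2}"
    show "isCont h' x"
    proof (cases "x = 0")
      case True
      have "((\<lambda>x::real. cos x / (sin x)\<^sup>2 - 1 / x\<^sup>2) \<longlongrightarrow> - 1 / 6) (at 0)" by real_asymp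
      then have "(h' \<longlongrightarrow> - 1 / 6) (at 0)"
        by (rule Lim_transform_eventually) (auto simp: h'_def eventually_at_filter)
      then show ?thesis using True by (simp add: isCont_def h'_def)
    next
      case False
      then have "sin x > 0" using x by (intro sin_gt_zero) auto
      then have "isCont (\<lambda>x::real. cos x / (sin x)\<^sup>2 - 1 / x\<^sup>2) x"
        using False by (intro continuous_intros) auto
      moreover have "eventually (\<lambda>y. h' y = cos y / (sin y)\<^sup>2 - 1 / y\<^sup>2) (nhds x)"
        using t1_space_nhds[OF False] by eventually_elim (simp add: h'_def)
      ultimately show ?thesis by (subst isCont_cong)
    qed
  qed
  have hd: "(h has_real_derivative h' x) (at x)" if "x \<in> {0<..<pi/2}" for x
  proof -
    have "sin x > 0" using that by (intro sin_gt_zero) auto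
    then have "(h has_real_derivative cos x / (sin x)\<^sup>2 - 1 / x\<^sup>2) (at x)"
      unfolding h_def using that by (auto intro!: derivative_eq_intros simp: power2_eq_square)
    then show ?thesis using that by (simp add: h'_def)
  qed
  have hc: "continuous_on {0..pi/2} h" unfolding h_def by (rule continuous_on_inverse_minus_csc)
  define B where "B = integral {0..pi/2} (\<lambda>x. \<bar>h' x\<bar>)"
  have bound: "\<bar>integral {0..pi/2} (\<lambda>x. h x * cos (2 * real M * x))\<bar> \<le> B / (2 * real M)" if M: "M > 0" for M
  proof -
    have "((\<lambda>x. h' x * sin (2 * real M * x) / (2 * real M) + h x * cos (2 * real M * x)) has_integral
       (h (pi/2) * sin (2 * real M * (pi/2)) / (2 * real M) - h 0 * sin (2 * real M * 0) / (2 * real M))) {0..pi/2}"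
      using M
      by (intro fundamental_theorem_of_calculus_interior)
         (auto intro!: continuous_intros hc derivative_eq_intros hd simp: field_simps
             simp flip: has_real_derivative_iff_has_vector_derivative)
    then have 1: "((\<lambda>x. h' x * sin (2 * real M * x) / (2 * real M) + h x * cos (2 * real M * x)) has_integral 0) {0..pi/2}"
      by simp
    have i: "(\<lambda>x. h' x * sin (2 * real M * x) / (2 * real M)) integrable_on {0..pi/2}"
      by (intro integrable_continuous_interval continuous_intros h'c) (use M in auto)
    have "((\<lambda>x. h x * cos (2 * real M * x)) has_integral
        - integral {0..pi/2} (\<lambda>x. h' x * sin (2 * real M * x) / (2 * real M))) {0..pi/2}"
      using has_integral_diff[OF 1 integrable_integral[OF i]] by simp
    then have "\<bar>integral {0..pi/2} (\<lambda>x. h x * cos (2 * real M * x))\<bar>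
        = norm (integral {0..pi/2} (\<lambda>x. h' x * sin (2 * real M * x) / (2 * real M)))"
      by (simp add: integral_unique)
    also have "\<dots> \<le> integral {0..pi/2} (\<lambda>x. \<bar>h' x\<bar> / (2 * real M))"
    proof (rule integral_norm_bound_integral[OF i])
      show "(\<lambda>x. \<bar>h' x\<bar> / (2 * real M)) integrable_on {0..pi/2}"
        by (intro integrable_continuous_interval continuous_intros h'c) (use M in auto)
      show "norm (h' x * sin (2 * real M * x) / (2 * real M)) \<le> \<bar>h' x\<bar> / (2 * real M)" for x
        by (simp add: abs_mult divide_right_mono mult_left_le)
    qed
    also have "\<dots> = B / (2 * real M)" unfolding B_def by simp
    finally show ?thesis .
  qed
  have "(\<lambda>M. B / (2 * real M)) \<longlonglongrightarrow> 0" by real_asymp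
  moreover have "eventually (\<lambda>M. norm (integral {0..pi/2} (\<lambda>x. h x * cos (2 * real M * x))) \<le> B / (2 * real M)) sequentially"
    using eventually_gt_at_top[of 0] by eventually_elim (use bound in auto)
  ultimately show ?thesis unfolding h_def[symmetric] by (rule Lim_null_comparison[rotated])
qed

text \<open>
  After rescaling, \<open>Cin (\<pi>M)\<close> is the integral of \<open>(1 - cos 2Mx)/x\<close> over \<open>[0, \<pi>/2]\<close>. Replacing \<open>1/x\<close> by
  \<open>1/sin x\<close> makes it a combination of harmonic numbers, the source of Euler's constant, and changes it by
  \<open>ln (\<pi>/4) + o(1)\<close>.
\<close>

lemma Cin_asymptotics: "(\<lambda>M. Cin (pi * real M) - ln (real M)) \<longlonglongrightarrow> euler_mascheroni + ln pi"
proof -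
  let ?h = "\<lambda>x::real. 1 / x - 1 / sin x"
  let ?E = "\<lambda>M. integral {0..pi/2} (\<lambda>x. ?h x * cos (2 * real M * x))"
  let ?a = "\<lambda>n. harm n - ln (real n)"
  have eq: "Cin (pi * real M) - ln (real M) = ln (pi / 4) - ?E M + 2 * ?a (2 * M) - ?a M + 2 * ln 2"
    if M: "M > 0" for M
  proof -
    have i: "(\<lambda>x. ?h x * cos (2 * real M * x)) integrable_on {0..pi/2}"
      by (intro integrable_continuous_interval continuous_intros continuous_on_inverse_minus_csc)
    have A: "((\<lambda>x. ?h x - ?h x * cos (2 * real M * x)) has_integral (ln (pi / 4) - ?E M)) {0..pi/2}"
      by (intro has_integral_diff has_integral_inverse_minus_csc integrable_integral i)
    have B: "((\<lambda>x. (1 - cos (2 * real M * x)) / x - (1 - cos (2 * real M * x)) / sin x) has_integral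
        (Cin (pi * real M) - (2 * harm (2 * M) - harm M))) {0..pi/2}"
      by (intro has_integral_diff has_integral_Cin has_integral_one_minus_cos_div_sin M)
    have AB: "(1 - cos (2 * real M * x)) / x - (1 - cos (2 * real M * x)) / sin x
        = ?h x - ?h x * cos (2 * real M * x)" for x
      by (simp add: diff_divide_distrib algebra_simps)
    have "Cin (pi * real M) - (2 * harm (2 * M) - harm M) = ln (pi / 4) - ?E M"
      by (rule has_integral_unique[OF B[unfolded AB] A])
    moreover have "ln (real (2 * M)) = ln 2 + ln (real M)" using M by (simp add: ln_mult_pos)
    ultimately show ?thesis by (simp add: algebra_simps)
  qed
  have "(\<lambda>M. ?a (2 * M)) \<longlonglongrightarrow> euler_mascheroni"
    by (rule filterlim_compose[OF euler_mascheroni_LIMSEQ]) (rule mult_nat_left_at_top, simp)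
  then have lim: "(\<lambda>M. ln (pi / 4) - ?E M + 2 * ?a (2 * M) - ?a M + 2 * ln 2) \<longlonglongrightarrow>
      ln (pi / 4) - 0 + 2 * euler_mascheroni - euler_mascheroni + 2 * ln 2"
    by (intro tendsto_intros integral_inverse_minus_csc_cos_tendsto_0 euler_mascheroni_LIMSEQ)
  have const: "ln (pi / 4) - 0 + 2 * euler_mascheroni - euler_mascheroni + 2 * ln 2 = euler_mascheroni + ln pi"
    using ln_realpow[of 2 2] by (simp add: ln_div)
  have "eventually (\<lambda>M. ln (pi / 4) - ?E M + 2 * ?a (2 * M) - ?a M + 2 * ln 2
        = Cin (pi * real M) - ln (real M)) sequentially"
    using eventually_gt_at_top[of 0] by eventually_elim (rule eq[symmetric])
  with lim show ?thesis unfolding const by (rule Lim_transform_eventually)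
qed

text \<open>
  Since \<open>sin (2\<pi>nx)\<close> has period 1, this is an integral of \<open>ln t sin (2\<pi>nt)\<close> over \<open>[k, k+1]\<close>. Choosing
  \<open>1 - cos\<close> as antiderivative of \<open>sin\<close> kills the boundary terms and leaves the cosine integral.
\<close>

lemma has_integral_ln_shift_sin:
  assumes n: "n > 0"
  shows "((\<lambda>x. ln (x + real k) * sin (2 * pi * real n * x)) has_integral
      (Cin (2 * pi * real n * real k) - Cin (2 * pi * real n * real (Suc k))) / (2 * pi * real n)) {0..1}"
proof -
  let ?w = "2 * pi * real n"
  have w: "?w > 0" using n by simp
  define G where "G x = ((1 - cos (?w * x)) * ln (x + real k) - Cin (?w * (x + real k))) / ?w" for x
  have per: "cos (?w * (x + real k)) = cos (?w * x)" for x
  proof -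
    have "?w * (x + real k) = ?w * x + 2 * pi * of_int (int (n * k))" by (simp add: algebra_simps)
    then show ?thesis using cos_int_2pin[of "int (n * k)"] sin_int_2pin[of "int (n * k)"]
      by (simp only: cos_add)
  qed
  have "((\<lambda>x. ln (x + real k) * sin (?w * x)) has_integral (G 1 - G 0)) {0..1}"
  proof (rule fundamental_theorem_of_calculus_interior)
    \<comment> \<open>For \<open>k = 0\<close> the factor \<open>1 - cos\<close> vanishes at the singularity of the logarithm.\<close>
    have 1: "continuous_on {0..1} (\<lambda>x. (1 - cos (?w * x)) * ln (x + real k))"
    proof (cases "k = 0")
      case True
      have c1: "continuous_on {0..1} (\<lambda>x. (1 - cos (?w * x)) / (?w * x))"
        by (rule continuous_on_compose2[OF continuous_on_one_minus_cos_div[of UNIV], of _ "\<lambda>x. ?w * x"])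
           (intro continuous_intros, simp)
      have c2: "continuous_on {0..1} (\<lambda>x::real. x * ln x)"
        by (rule continuous_on_subset[OF continuous_on_mult_ln]) auto
      have "continuous_on {0..1} (\<lambda>x. ?w * ((1 - cos (?w * x)) / (?w * x)) * (x * ln x))"
        by (rule continuous_on_mult[OF continuous_on_mult[OF continuous_on_const c1] c2])
      moreover have "?w * ((1 - cos (?w * x)) / (?w * x)) * (x * ln x) = (1 - cos (?w * x)) * ln (x + real k)" for x
        using w True by (cases "x = 0") simp_all
      ultimately show ?thesis by (simp only:)
    next
      case False
      then show ?thesis by (intro continuous_intros) auto
    qed
    have "(\<lambda>x. ?w * (x + real k)) ` {0..1} \<subseteq> {0..?w * (1 + real k)}"
    proof (rule image_subsetI)
      fix x :: real assume x: "x \<in> {0..1}"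
      have "?w * (x + real k) \<le> ?w * (1 + real k)" using x w by (intro mult_left_mono) auto
      moreover have "0 \<le> ?w * (x + real k)" using x w by (intro mult_nonneg_nonneg) auto
      ultimately show "?w * (x + real k) \<in> {0..?w * (1 + real k)}" by simp
    qed
    then have 2: "continuous_on {0..1} (\<lambda>x. Cin (?w * (x + real k)))"
      by (intro continuous_on_compose2[OF continuous_on_Cin] continuous_intros)
    show "continuous_on {0..1} G"
      unfolding G_def by (intro continuous_intros 1 2) (use n in auto)
    fix x :: real assume x: "x \<in> {0<..<1}"
    have "((\<lambda>x. Cin (?w * (x + real k))) has_real_derivative
        (1 - cos (?w * (x + real k))) / (?w * (x + real k)) * ?w) (at x)"
      using x n by (intro DERIV_chain2[OF Cin_derivative] mult_pos_pos) (auto intro!: derivative_eq_intros)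
    moreover have "((\<lambda>x. (1 - cos (?w * x)) * ln (x + real k)) has_real_derivative
        (1 - cos (?w * x)) / (x + real k) + ?w * sin (?w * x) * ln (x + real k)) (at x)"
      using x by (auto intro!: derivative_eq_intros)
    ultimately have "(G has_real_derivative
        ((1 - cos (?w * x)) / (x + real k) + ?w * sin (?w * x) * ln (x + real k)
          - (1 - cos (?w * (x + real k))) / (?w * (x + real k)) * ?w) / ?w) (at x)"
      unfolding G_def by (intro DERIV_cdivide DERIV_diff)
    moreover have "((1 - cos (?w * x)) / (x + real k) + ?w * sin (?w * x) * ln (x + real k)
          - (1 - cos (?w * (x + real k))) / (?w * (x + real k)) * ?w) / ?w = ln (x + real k) * sin (?w * x)"
      unfolding per using n x by simp
    ultimately show "(G has_vector_derivative ln (x + real k) * sin (?w * x)) (at x)"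
      by (simp only: has_real_derivative_iff_has_vector_derivative)
  qed auto
  moreover have "cos ?w = 1" using cos_int_2pin[of "int n"] by simp
  then have "G 1 - G 0 = (Cin (?w * real k) - Cin (?w * real (Suc k))) / ?w"
    by (simp add: G_def diff_divide_distrib add.commute)
  ultimately show ?thesis by simp
qed

lemma has_integral_sin_2pi:
  assumes n: "n > 0"
  shows "((\<lambda>x. (a * x + b) * sin (2 * pi * real n * x)) has_integral - a / (2 * pi * real n)) {0..1}"
proof -
  let ?w = "2 * pi * real n"
  have "((\<lambda>x. (a * x + b) * sin (?w * x)) has_integral
     ((a * sin (?w * 1) / ?w - (a * 1 + b) * cos (?w * 1)) / ?w
      - (a * sin (?w * 0) / ?w - (a * 0 + b) * cos (?w * 0)) / ?w)) {0..1}"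
    using n
    by (intro fundamental_theorem_of_calculus_interior)
       (auto intro!: continuous_intros derivative_eq_intros simp: field_simps
             simp flip: has_real_derivative_iff_has_vector_derivative)
  moreover have "cos ?w = 1" "sin ?w = 0" using cos_int_2pin[of "int n"] sin_int_2pin[of "int n"] by simp_all
  ultimately show ?thesis by (simp add: diff_divide_distrib)
qed

text \<open>
  Insert Euler's series for \<open>ln \<Gamma>\<close>. Its logarithms integrate to a telescoping sum of values of \<open>Cin\<close>,
  its linear term \<open>x ln N\<close> to \<open>- ln N / (2\<pi>n)\<close>; the asymptotics of \<open>Cin\<close> make the two divergences
  cancel.
\<close>

lemma fourier_sin_ln_Gamma:
  assumes n: "n > 0"
  shows "fourier_sin (\<lambda>x. ln (Gamma x)) n = (euler_mascheroni + ln (2 * pi * real n)) / (2 * pi * real n)"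
proof -
  let ?w = "2 * pi * real n"
  have int: "integral {0..1} (\<lambda>x. ln_Gamma_series x N * sin (?w * x))
      = (Cin (pi * real (2 * n * Suc N)) - ln (real N)) / ?w" if N: "N > 0" for N
  proof -
    have "((\<lambda>x. (ln (real N) * x + (\<Sum>k=1..N. ln (real k))) * sin (?w * x)
            - (\<Sum>k<Suc N. ln (x + real k) * sin (?w * x))) has_integral
          - ln (real N) / ?w - (\<Sum>k<Suc N. (Cin (?w * real k) - Cin (?w * real (Suc k))) / ?w)) {0..1}"
      by (intro has_integral_diff has_integral_sin_2pi has_integral_sum has_integral_ln_shift_sin n) auto
    note ser = this
    have tele: "(\<Sum>k<Suc N. (Cin (?w * real k) - Cin (?w * real (Suc k))) / ?w) = - Cin (?w * real (Suc N)) / ?w"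
      unfolding sum_divide_distrib[symmetric] by (subst sum_lessThan_telescope') simp
    have eq: "(ln (real N) * x + (\<Sum>k=1..N. ln (real k))) * sin (?w * x)
            - (\<Sum>k<Suc N. ln (x + real k) * sin (?w * x)) = ln_Gamma_series x N * sin (?w * x)"
      if x: "x \<in> {0..1}" for x
    proof -
      have "(\<Sum>k<Suc N. ln (x + real k)) = ln x + (\<Sum>k=1..N. ln (x + real k))"
        by (subst sum.lessThan_Suc_shift) (simp add: sum.atLeast1_atMost_eq)
      moreover have "(\<Sum>k=1..N. ln (x / real k + 1)) = (\<Sum>k=1..N. ln (x + real k) - ln (real k))"
      proof (rule sum.cong[OF refl])
        fix k assume k: "k \<in> {1..N}"
        then have "x / real k + 1 = (x + real k) / real k" by (simp add: field_simps)
        then show "ln (x / real k + 1) = ln (x + real k) - ln (real k)" using x k by (simp add: ln_div)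
      qed
      ultimately have "ln_Gamma_series x N
          = ln (real N) * x + (\<Sum>k=1..N. ln (real k)) - (\<Sum>k<Suc N. ln (x + real k))"
        by (simp only: ln_Gamma_series_def sum_subtractf) (simp add: algebra_simps)
      then show ?thesis by (simp only: sum_distrib_right[symmetric] left_diff_distrib)
    qed
    have "((\<lambda>x. ln_Gamma_series x N * sin (?w * x)) has_integral
          - ln (real N) / ?w - (- Cin (?w * real (Suc N)) / ?w)) {0..1}"
      by (rule has_integral_eq[OF eq ser[unfolded tele]])
    moreover have "?w * real (Suc N) = pi * real (2 * n * Suc N)" by (simp add: algebra_simps)
    ultimately show ?thesis by (simp add: integral_unique diff_divide_distrib del: of_nat_Suc)
  qed
  have "(\<lambda>N. Cin (pi * real (2 * n * Suc (Suc N))) - ln (real (2 * n * Suc (Suc N)))) \<longlonglongrightarrow> euler_mascheroni + ln pi"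
  proof (rule filterlim_compose[OF Cin_asymptotics])
    show "filterlim (\<lambda>N. 2 * n * Suc (Suc N)) at_top sequentially"
      using n by (intro filterlim_at_top_mono[OF filterlim_ident] always_eventually allI) (cases n; simp)
  qed
  moreover have "(\<lambda>N. ln (real (Suc (Suc N)) / real (Suc N))) \<longlonglongrightarrow> 0" by real_asymp
  ultimately have "(\<lambda>N. ((Cin (pi * real (2 * n * Suc (Suc N))) - ln (real (2 * n * Suc (Suc N))))
      + ln (2 * real n) + ln (real (Suc (Suc N)) / real (Suc N))) / ?w)
      \<longlonglongrightarrow> (euler_mascheroni + ln pi + ln (2 * real n) + 0) / ?w"
    using n by (intro tendsto_intros) auto
  moreover have "((Cin (pi * real (2 * n * Suc (Suc N))) - ln (real (2 * n * Suc (Suc N))))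
      + ln (2 * real n) + ln (real (Suc (Suc N)) / real (Suc N))) / ?w
      = integral {0..1} (\<lambda>x. ln_Gamma_series x (Suc N) * sin (?w * x))" for N
  proof -
    have "ln (real (2 * n * Suc (Suc N))) = ln (2 * real n) + ln (real (Suc (Suc N)))"
    proof -
      have "real (2 * n * Suc (Suc N)) = (2 * real n) * real (Suc (Suc N))"
        by (simp only: of_nat_mult of_nat_numeral)
      also have "ln \<dots> = ln (2 * real n) + ln (real (Suc (Suc N)))"
        using n by (intro ln_mult_pos) auto
      finally show ?thesis .
    qed
    moreover have "ln (real (Suc (Suc N)) / real (Suc N)) = ln (real (Suc (Suc N))) - ln (real (Suc N))"
      by (simp add: ln_div del: of_nat_Suc)
    ultimately have "(Cin (pi * real (2 * n * Suc (Suc N))) - ln (real (2 * n * Suc (Suc N))))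
        + ln (2 * real n) + ln (real (Suc (Suc N)) / real (Suc N))
        = Cin (pi * real (2 * n * Suc (Suc N))) - ln (real (Suc N))"
      by linarith
    then show ?thesis unfolding int[of "Suc N", OF zero_less_Suc] by (rule arg_cong)
  qed
  ultimately have "(\<lambda>N. integral {0..1} (\<lambda>x. ln_Gamma_series x (Suc N) * sin (?w * x)))
      \<longlonglongrightarrow> (euler_mascheroni + ln pi + ln (2 * real n) + 0) / ?w"
    by (simp only:)
  moreover have "(\<lambda>N. integral {0..1} (\<lambda>x. ln_Gamma_series x (Suc N) * sin (?w * x)))
     \<longlonglongrightarrow> fourier_sin (\<lambda>x. ln (Gamma x)) n"
    unfolding fourier_sin_def by (intro ln_Gamma_series_integral_LIMSEQ continuous_intros)
  ultimately have "fourier_sin (\<lambda>x. ln (Gamma x)) n = (euler_mascheroni + ln pi + ln (2 * real n) + 0) / ?w"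
    using LIMSEQ_unique by blast
  also have "\<dots> = (euler_mascheroni + ln (2 * pi * real n)) / ?w"
    using n by (simp add: ln_mult_pos)
  finally show ?thesis .
qed

lemma summable_fourier_ln_Gamma:
  "summable (\<lambda>n. \<bar>fourier_cos (\<lambda>x. ln (Gamma x)) n\<bar> / real n)"
  "summable (\<lambda>n. \<bar>fourier_sin (\<lambda>x. ln (Gamma x)) n\<bar> / real n)"
proof -
  have sm: "summable (\<lambda>n. norm (real n powr (-3/2)))"
    by (simp add: summable_real_powr_iff)
  have "summable (\<lambda>n. \<bar>1 / (4 * real n)\<bar> / real n)"
    by (rule summable_comparison_test_bigo[OF sm]) real_asymp
  then show "summable (\<lambda>n. \<bar>fourier_cos (\<lambda>x. ln (Gamma x)) n\<bar> / real n)"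
    by (rule summable_cong[THEN iffD1, rotated])
       (use eventually_gt_at_top[of 0] in \<open>eventually_elim, simp add: fourier_cos_ln_Gamma\<close>)
  have "summable (\<lambda>n. \<bar>(euler_mascheroni + ln (2 * pi * real n)) / (2 * pi * real n)\<bar> / real n)"
    by (rule summable_comparison_test_bigo[OF sm]) real_asymp
  then show "summable (\<lambda>n. \<bar>fourier_sin (\<lambda>x. ln (Gamma x)) n\<bar> / real n)"
    by (rule summable_cong[THEN iffD1, rotated])
       (use eventually_gt_at_top[of 0] in \<open>eventually_elim, simp add: fourier_sin_ln_Gamma\<close>)
qed

section \<open>Digamma and cotangent series, and the coefficients of the cosine\<close>

text \<open>
  Add the limit formulas \<open>\<psi> z = lim (ln m - \<Sum>n<m. 1/(z+n))\<close> for \<open>z\<close> and \<open>-z\<close>. The terms with \<open>n = 0\<close>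
  cancel, and the others pair up to \<open>2n/(n\<^sup>2 - z\<^sup>2) = 2/n + 2z\<^sup>2/(n(n\<^sup>2 - z\<^sup>2))\<close>.
\<close>

lemma Digamma_symmetric_sums:
  fixes z :: real
  assumes z: "z \<notin> \<int>"
  shows "(\<lambda>k. 1 / (real (Suc k) * ((real (Suc k))\<^sup>2 - z\<^sup>2))) sums
     (- (Digamma z + Digamma (- z) + 2 * euler_mascheroni) / (2 * z\<^sup>2))"
proof -
  have z0: "z \<noteq> 0" using z by auto
  have ne: "real k + z \<noteq> 0" "real k - z \<noteq> 0" for k
  proof -
    have "z \<noteq> of_int (- int k)" "z \<noteq> of_int (int k)" using z by (metis Ints_of_int)+
    then show "real k + z \<noteq> 0" "real k - z \<noteq> 0" by auto
  qed
  let ?t = "\<lambda>k. 1 / (real (Suc k) * ((real (Suc k))\<^sup>2 - z\<^sup>2))"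
  have "(\<lambda>m. (ln (real m) - (\<Sum>n<m. inverse (z + real n))) + (ln (real m) - (\<Sum>n<m. inverse (- z + real n))))
          \<longlonglongrightarrow> Digamma z + Digamma (- z)"
    using Digamma_LIMSEQ[of z] Digamma_LIMSEQ[of "- z"] z0 by (intro tendsto_add) auto
  then have "(\<lambda>m. (ln (real (Suc m)) - (\<Sum>n<Suc m. inverse (z + real n)))
          + (ln (real (Suc m)) - (\<Sum>n<Suc m. inverse (- z + real n))))
          \<longlonglongrightarrow> Digamma z + Digamma (- z)"
    by (rule LIMSEQ_Suc)
  moreover have "(ln (real (Suc m)) - (\<Sum>n<Suc m. inverse (z + real n)))
          + (ln (real (Suc m)) - (\<Sum>n<Suc m. inverse (- z + real n)))
        = 2 * ln (real (Suc m)) - 2 * harm m - 2 * z\<^sup>2 * (\<Sum>k<m. ?t k)" for m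
  proof -
    have t: "inverse (z + real (Suc k)) + inverse (- z + real (Suc k)) = 2 * inverse (real (Suc k)) + 2 * z\<^sup>2 * ?t k" for k
    proof -
      define n where "n = real (Suc k)"
      have n: "n \<noteq> 0" "n + z \<noteq> 0" "n - z \<noteq> 0" using ne[of "Suc k"] by (auto simp: n_def)
      have "inverse (z + n) + inverse (- z + n) = 2 * n / ((n + z) * (n - z))"
        using n by (simp add: field_simps)
      also have prod: "(n + z) * (n - z) = n\<^sup>2 - z\<^sup>2" by (simp add: power2_eq_square algebra_simps)
      also have "2 * n / (n\<^sup>2 - z\<^sup>2) = 2 * inverse n + 2 * z\<^sup>2 * (1 / (n * (n\<^sup>2 - z\<^sup>2)))"
      proof -
        have "n\<^sup>2 - z\<^sup>2 \<noteq> 0" using n by (simp flip: prod)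
        then show ?thesis using n(1) by (simp add: divide_simps) (simp add: power2_eq_square algebra_simps)
      qed
      finally show ?thesis by (simp only: n_def)
    qed
    have "(\<Sum>n<Suc m. inverse (z + real n)) + (\<Sum>n<Suc m. inverse (- z + real n))
        = (\<Sum>k<m. inverse (z + real (Suc k)) + inverse (- z + real (Suc k)))"
      unfolding sum.lessThan_Suc_shift by (simp add: sum.distrib)
    also have "\<dots> = (\<Sum>k<m. 2 * inverse (real (Suc k)) + 2 * z\<^sup>2 * ?t k)"
      by (simp only: t)
    also have "\<dots> = 2 * harm m + 2 * z\<^sup>2 * (\<Sum>k<m. ?t k)"
      by (simp only: sum.distrib sum_distrib_left[symmetric]) (simp add: harm_def sum.atLeast1_atMost_eq)
    finally show ?thesis by linarith
  qed
  ultimately have 1: "(\<lambda>m. 2 * ln (real (Suc m)) - 2 * harm m - 2 * z\<^sup>2 * (\<Sum>k<m. ?t k)) \<longlonglongrightarrow> Digamma z + Digamma (- z)"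
    by (simp only:)
  have 2: "(\<lambda>m. 2 * ((harm m - ln (real m)) - (ln (real (Suc m)) - ln (real m)))) \<longlonglongrightarrow> 2 * (euler_mascheroni - 0)"
  proof (intro tendsto_mult tendsto_diff tendsto_const euler_mascheroni_LIMSEQ)
    show "(\<lambda>m. ln (real (Suc m)) - ln (real m)) \<longlonglongrightarrow> 0" by real_asymp
  qed
  have "(\<lambda>m. - (2 * ln (real (Suc m)) - 2 * harm m - 2 * z\<^sup>2 * (\<Sum>k<m. ?t k)
      + 2 * ((harm m - ln (real m)) - (ln (real (Suc m)) - ln (real m)))) / (2 * z\<^sup>2))
      \<longlonglongrightarrow> - (Digamma z + Digamma (- z) + 2 * (euler_mascheroni - 0)) / (2 * z\<^sup>2)"
    by (intro tendsto_intros 1 2) (use z0 in auto)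
  moreover have "- (2 * ln (real (Suc m)) - 2 * harm m - 2 * z\<^sup>2 * (\<Sum>k<m. ?t k)
      + 2 * ((harm m - ln (real m)) - (ln (real (Suc m)) - ln (real m)))) / (2 * z\<^sup>2) = (\<Sum>k<m. ?t k)" for m
    using z0 by (simp add: algebra_simps)
  ultimately show ?thesis unfolding sums_def by simp
qed

context
  fixes p :: real
  assumes not_even: "\<And>k :: int. p \<noteq> 2 * real_of_int k"
begin

lemma p_nonzero: "p \<noteq> 0" using not_even[of 0] by simp

lemma denominator_nonzero: "4 * (real n)\<^sup>2 - p\<^sup>2 \<noteq> 0"
proof
  assume "4 * (real n)\<^sup>2 - p\<^sup>2 = 0"
  then have "(p - 2 * real n) * (p + 2 * real n) = 0" by (simp add: power2_eq_square algebra_simps)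
  then have "p = 2 * real_of_int (int n) \<or> p = 2 * real_of_int (- int n)" by auto
  then show False using not_even by blast
qed

lemma integral_cos_p: "integral {0..1} (\<lambda>x. cos (p * pi * x)) = sin (p * pi) / (p * pi)"
proof -
  have "((\<lambda>x. cos (p * pi * x)) has_integral (sin (p * pi * 1) / (p * pi) - sin (p * pi * 0) / (p * pi))) {0..1}"
    using p_nonzero
    by (intro fundamental_theorem_of_calculus_interior)
       (auto intro!: continuous_intros derivative_eq_intros
             simp flip: has_real_derivative_iff_has_vector_derivative)
  then show ?thesis by (simp add: integral_unique)
qed

lemma frequency_nonzero: "(2 * pi * real n)\<^sup>2 - (p * pi)\<^sup>2 \<noteq> 0"
proof -
  have "(2 * pi * real n)\<^sup>2 - (p * pi)\<^sup>2 = pi\<^sup>2 * (4 * (real n)\<^sup>2 - p\<^sup>2)"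
    by (simp add: power2_eq_square algebra_simps)
  then show ?thesis using denominator_nonzero[of n] by simp
qed

lemma fourier_cos_cos_p:
  "fourier_cos (\<lambda>x. cos (p * pi * x)) n = - sin (p * pi) * p / (pi * (4 * (real n)\<^sup>2 - p\<^sup>2))"
proof -
  define a b D where "a = 2 * pi * real n" and "b = p * pi" and "D = a\<^sup>2 - b\<^sup>2"
  have D: "D \<noteq> 0" using frequency_nonzero[of n] by (simp add: D_def a_def b_def)
  define F where "F x = (a * cos (b * x) * sin (a * x) - b * sin (b * x) * cos (a * x)) / D" for x
  have "((\<lambda>x. cos (b * x) * cos (a * x)) has_integral (F 1 - F 0)) {0..1}"
  proof (rule fundamental_theorem_of_calculus_interior)
    fix x :: real
    have "((\<lambda>x. a * cos (b * x) * sin (a * x) - b * sin (b * x) * cos (a * x)) has_real_derivative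
        (a\<^sup>2 - b\<^sup>2) * (cos (b * x) * cos (a * x))) (at x)"
      by (auto intro!: derivative_eq_intros simp: power2_eq_square algebra_simps)
    from DERIV_cdivide[OF this, of D]
    have "(F has_real_derivative ((a\<^sup>2 - b\<^sup>2) * (cos (b * x) * cos (a * x))) / D) (at x)"
      unfolding F_def .
    then show "(F has_vector_derivative cos (b * x) * cos (a * x)) (at x)"
      using D by (simp add: has_real_derivative_iff_has_vector_derivative flip: D_def)
  qed (use D in \<open>auto simp: F_def intro!: continuous_intros\<close>)
  moreover have "sin a = 0" "cos a = 1"
    unfolding a_def using sin_int_2pin[of "int n"] cos_int_2pin[of "int n"] by simp_all
  ultimately have "fourier_cos (\<lambda>x. cos (p * pi * x)) n = - b * sin b / D"
    unfolding fourier_cos_def a_def[symmetric] b_def[symmetric] by (simp add: F_def integral_unique)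
  also have "D = pi * (pi * (4 * (real n)\<^sup>2 - p\<^sup>2))"
    by (simp add: D_def a_def b_def power2_eq_square algebra_simps)
  finally show ?thesis by (simp add: b_def mult.commute)
qed

lemma fourier_sin_cos_p:
  "fourier_sin (\<lambda>x. cos (p * pi * x)) n = (1 - cos (p * pi)) * (2 * real n) / (pi * (4 * (real n)\<^sup>2 - p\<^sup>2))"
proof -
  define a b D where "a = 2 * pi * real n" and "b = p * pi" and "D = a\<^sup>2 - b\<^sup>2"
  have D: "D \<noteq> 0" using frequency_nonzero[of n] by (simp add: D_def a_def b_def)
  define F where "F x = - (a * cos (a * x) * cos (b * x) + b * sin (a * x) * sin (b * x)) / D" for x
  have "((\<lambda>x. cos (b * x) * sin (a * x)) has_integral (F 1 - F 0)) {0..1}"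
  proof (rule fundamental_theorem_of_calculus_interior)
    fix x :: real
    have "((\<lambda>x. - (a * cos (a * x) * cos (b * x) + b * sin (a * x) * sin (b * x))) has_real_derivative
        (a\<^sup>2 - b\<^sup>2) * (cos (b * x) * sin (a * x))) (at x)"
      by (auto intro!: derivative_eq_intros simp: power2_eq_square algebra_simps)
    from DERIV_cdivide[OF this, of D]
    have "(F has_real_derivative ((a\<^sup>2 - b\<^sup>2) * (cos (b * x) * sin (a * x))) / D) (at x)"
      unfolding F_def .
    then show "(F has_vector_derivative cos (b * x) * sin (a * x)) (at x)"
      using D by (simp add: has_real_derivative_iff_has_vector_derivative flip: D_def)
  qed (use D in \<open>auto simp: F_def intro!: continuous_intros\<close>)
  moreover have "sin a = 0" "cos a = 1"
    unfolding a_def using sin_int_2pin[of "int n"] cos_int_2pin[of "int n"] by simp_all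
  ultimately have "fourier_sin (\<lambda>x. cos (p * pi * x)) n = a * (1 - cos b) / D"
    unfolding fourier_sin_def a_def[symmetric] b_def[symmetric]
    by (simp add: F_def integral_unique diff_divide_distrib algebra_simps)
  also have "D = pi * (pi * (4 * (real n)\<^sup>2 - p\<^sup>2))"
    by (simp add: D_def a_def b_def power2_eq_square algebra_simps)
  finally show ?thesis by (simp add: a_def b_def mult.commute mult.left_commute)
qed

lemma cos_p_parseval:
  assumes u: "u absolutely_integrable_on {0..1}" "continuous_on {0<..<1} u"
    and sC: "summable (\<lambda>n. \<bar>fourier_cos u n\<bar> / real n)"
    and sS: "summable (\<lambda>n. \<bar>fourier_sin u n\<bar> / real n)"
  shows "(\<lambda>n. fourier_cos u (Suc n) * (- sin (p * pi) * p / (pi * (4 * (real (Suc n))\<^sup>2 - p\<^sup>2)))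
         + fourier_sin u (Suc n) * ((1 - cos (p * pi)) * (2 * real (Suc n)) / (pi * (4 * (real (Suc n))\<^sup>2 - p\<^sup>2))))
     sums ((integral {0..1} (\<lambda>x. u x * cos (p * pi * x)) - integral {0..1} u * (sin (p * pi) / (p * pi))) / 2)"
proof -
  have "((\<lambda>x. cos (p * pi * x)) has_real_derivative - sin (p * pi * x) * (p * pi)) (at x)" for x
    by (auto intro!: derivative_eq_intros)
  from parseval_C1[OF u sC sS this] show ?thesis
    unfolding fourier_cos_cos_p fourier_sin_cos_p integral_cos_p
    by (simp only: continuous_intros)
qed

lemma summable_inverse_square: "summable (\<lambda>n. 1 / (real n)\<^sup>2)"
  using inverse_power_summable[of 2, where 'a = real] by (simp add: inverse_eq_divide)

text \<open>
  The partial fraction expansion of the cotangent, multiplied by \<open>1 - cos (p\<pi>)\<close>, is Parseval's identity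
  for \<open>u = 1/2 - x\<close>, whose sine coefficients are \<open>1/(2\<pi>n)\<close> and whose mean and cosine coefficients vanish.
\<close>

lemma cot_sums:
  "(\<lambda>n. (1 - cos (p * pi)) / pi\<^sup>2 * (1 / (4 * (real (Suc n))\<^sup>2 - p\<^sup>2)))
     sums ((1 - cos (p * pi)) / pi\<^sup>2 * (1 / (2 * p\<^sup>2) - pi / (4 * p) * cot (p * pi / 2)))"
proof -
  define u where "u x = 1 / 2 - x" for x :: real
  define b where "b = p * pi"
  have b: "b \<noteq> 0" using p_nonzero by (simp add: b_def)
  have S: "fourier_sin u n = 1 / (2 * pi * real n)" if "n > 0" for n
    using has_integral_sin_2pi[OF that, of "-1" "1/2"]
    by (simp add: fourier_sin_def u_def integral_unique)
  have C: "fourier_cos u n = 0" for n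
  proof -
    define a where "a = 2 * pi * real n"
    have s: "sin a = 0" "cos a = 1"
      unfolding a_def using sin_int_2pin[of "int n"] cos_int_2pin[of "int n"] by simp_all
    have "((\<lambda>x. u x * cos (a * x)) has_integral 0) {0..1}"
    proof (cases "a = 0")
      case True
      have "((\<lambda>x. 1 / 2 - x) has_integral ((1/2 * 1 - 1\<^sup>2 / 2) - (1/2 * 0 - 0\<^sup>2 / 2))) {0..1::real}"
        by (rule fundamental_theorem_of_calculus_interior)
           (auto intro!: continuous_intros derivative_eq_intros
             simp flip: has_real_derivative_iff_has_vector_derivative)
      then show ?thesis using True by (simp add: u_def)
    next
      case False
      have "((\<lambda>x. u x * cos (a * x)) has_integral
        (((1/2 - 1) * sin (a * 1) / a - cos (a * 1) / a\<^sup>2) - ((1/2 - 0) * sin (a * 0) / a - cos (a * 0) / a\<^sup>2))) {0..1}"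
        unfolding u_def using False
        by (intro fundamental_theorem_of_calculus_interior)
           (auto intro!: continuous_intros derivative_eq_intros simp: power2_eq_square diff_divide_distrib
             simp flip: has_real_derivative_iff_has_vector_derivative)
      then show ?thesis by (simp add: s)
    qed
    then show ?thesis by (simp add: fourier_cos_def integral_unique a_def)
  qed
  have uc: "continuous_on A u" for A unfolding u_def by (intro continuous_intros)
  have sS: "summable (\<lambda>n. \<bar>fourier_sin u n\<bar> / real n)"
  proof (rule summable_comparison_test_ev[OF _ summable_inverse_square])
    show "eventually (\<lambda>n. norm (\<bar>fourier_sin u n\<bar> / real n) \<le> 1 / (real n)\<^sup>2) sequentially"
      using eventually_gt_at_top[of 0]
    proof eventually_elim
      case (elim n)
      have "1 \<le> 2 * pi" using pi_gt3 by simp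
      from divide_left_mono[OF this, of "1 / (real n)\<^sup>2"] elim show ?case
        by (simp add: S power2_eq_square field_simps)
    qed
  qed
  have mean: "integral {0..1} u = 0" using C[of 0] by (simp add: fourier_cos_def)
  have "((\<lambda>x. u x * cos (b * x)) has_integral
        (((1/2 - 1) * sin (b * 1) / b - cos (b * 1) / b\<^sup>2) - ((1/2 - 0) * sin (b * 0) / b - cos (b * 0) / b\<^sup>2))) {0..1}"
        unfolding u_def using b
        by (intro fundamental_theorem_of_calculus_interior)
           (auto intro!: continuous_intros derivative_eq_intros simp: power2_eq_square diff_divide_distrib
             simp flip: has_real_derivative_iff_has_vector_derivative)
  then have J: "integral {0..1} (\<lambda>x. u x * cos (b * x)) = (1 - cos b) / b\<^sup>2 - sin b / (2 * b)"
    by (simp add: integral_unique diff_divide_distrib)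
  have "(\<lambda>n. fourier_cos u (Suc n) * (- sin (p * pi) * p / (pi * (4 * (real (Suc n))\<^sup>2 - p\<^sup>2)))
         + fourier_sin u (Suc n) * ((1 - cos (p * pi)) * (2 * real (Suc n)) / (pi * (4 * (real (Suc n))\<^sup>2 - p\<^sup>2))))
     sums ((integral {0..1} (\<lambda>x. u x * cos (p * pi * x)) - integral {0..1} u * (sin (p * pi) / (p * pi))) / 2)"
    by (intro cos_p_parseval absolutely_integrable_continuous_real uc sS) (simp add: C)
  moreover have "fourier_cos u (Suc n) * (- sin (p * pi) * p / (pi * (4 * (real (Suc n))\<^sup>2 - p\<^sup>2)))
         + fourier_sin u (Suc n) * ((1 - cos (p * pi)) * (2 * real (Suc n)) / (pi * (4 * (real (Suc n))\<^sup>2 - p\<^sup>2)))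
       = (1 - cos (p * pi)) / pi\<^sup>2 * (1 / (4 * (real (Suc n))\<^sup>2 - p\<^sup>2))" for n
    unfolding C S[OF zero_less_Suc] by (simp add: power2_eq_square del: of_nat_Suc)
  moreover have "(integral {0..1} (\<lambda>x. u x * cos (p * pi * x)) - integral {0..1} u * (sin (p * pi) / (p * pi))) / 2
      = (1 - cos (p * pi)) / pi\<^sup>2 * (1 / (2 * p\<^sup>2) - pi / (4 * p) * cot (p * pi / 2))"
  proof -
    have s: "sin (b / 2) \<noteq> 0"
    proof
      assume "sin (b / 2) = 0"
      then obtain k :: int where "b / 2 = of_int k * pi" unfolding sin_zero_iff_int2 by blast
      then have "p = 2 * real_of_int k" by (simp add: b_def)
      then show False using not_even by blast
    qed
    have "cos b = 1 - 2 * (sin (b / 2))\<^sup>2" "sin b = 2 * sin (b / 2) * cos (b / 2)"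
      using cos_double_sin[of "b/2"] sin_double[of "b/2"] by simp_all
    then have "(1 - cos b) * cot (b / 2) = sin b"
      using s by (simp add: cot_def power2_eq_square)
    then have "(1 - cos b) / pi\<^sup>2 * (1 / (2 * p\<^sup>2) - pi / (4 * p) * cot (b / 2)) = (1 - cos b) / (2 * b\<^sup>2) - sin b / (4 * b)"
      using p_nonzero by (simp add: b_def power2_eq_square right_diff_distrib mult_ac)
    moreover have "(x / y - v / (2 * w)) / 2 = x / (2 * y) - v / (4 * w)" for x y v w :: real
      by (simp add: diff_divide_distrib)
    ultimately show ?thesis unfolding mean J[unfolded b_def] by (simp only: b_def mult_zero_left diff_zero)
  qed
  ultimately show ?thesis by (simp only:)
qed

lemma digamma_sums:
  "(\<lambda>n. 1 / (real (Suc n) * (4 * (real (Suc n))\<^sup>2 - p\<^sup>2)))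
     sums (- (Digamma (p / 2) + Digamma (- p / 2) + 2 * euler_mascheroni) / (2 * p\<^sup>2))"
proof -
  have "p / 2 \<notin> \<int>"
  proof
    assume "p / 2 \<in> \<int>"
    then obtain k :: int where "p / 2 = of_int k" by (auto elim: Ints_cases)
    then have "p = 2 * real_of_int k" by simp
    then show False using not_even by blast
  qed
  from sums_mult[OF Digamma_symmetric_sums[OF this], of "1/4"]
  have "(\<lambda>k. 1/4 * (1 / (real (Suc k) * ((real (Suc k))\<^sup>2 - (p/2)\<^sup>2)))) sums
     (1/4 * (- (Digamma (p/2) + Digamma (- (p/2)) + 2 * euler_mascheroni) / (2 * (p/2)\<^sup>2)))" .
  moreover have "1/4 * (1 / (real (Suc k) * ((real (Suc k))\<^sup>2 - (p/2)\<^sup>2))) = 1 / (real (Suc k) * (4 * (real (Suc k))\<^sup>2 - p\<^sup>2))" for k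
  proof -
    have "4 * (real (Suc k))\<^sup>2 - p\<^sup>2 = 4 * ((real (Suc k))\<^sup>2 - (p/2)\<^sup>2)"
      by (simp add: power_divide)
    then show ?thesis by (simp only:) (simp del: of_nat_Suc)
  qed
  moreover have "1/4 * (- (Digamma (p/2) + Digamma (- (p/2)) + 2 * euler_mascheroni) / (2 * (p/2)\<^sup>2))
      = - (Digamma (p / 2) + Digamma (- p / 2) + 2 * euler_mascheroni) / (2 * p\<^sup>2)"
    using p_nonzero by (simp add: power_divide field_simps)
  ultimately show ?thesis by (simp only:)
qed

lemma summable_ln_over_square: "summable (\<lambda>n. ln (real n) / (4 * (real n)\<^sup>2 - p\<^sup>2))"
proof (rule summable_comparison_test_bigo)
  show "summable (\<lambda>n. norm (real n powr (-3/2)))"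
    by (simp add: summable_real_powr_iff)
  show "(\<lambda>n. ln (real n) / (4 * (real n)\<^sup>2 - p\<^sup>2)) \<in> O(\<lambda>n. real n powr (-3/2))"
    by real_asymp
qed

end

section \<open>The integral of the logarithm of the Gamma function against a cosine\<close>

lemma solve_parseval_for_integral:
  fixes p s A e l q c t J :: real
  assumes eq: "(J - l / 2 * (s / (p * pi))) / 2 =
      - (s * p / (4 * pi)) * (- (A + 2 * e) / (2 * p\<^sup>2)) + (e + l) * (c / pi\<^sup>2 * q) + c / pi\<^sup>2 * t"
    and p: "p \<noteq> 0"
  shows "J = s * (e + l) / (2 * p * pi) + s / (4 * p * pi) * A + 2 * c * (e + l) / pi\<^sup>2 * q + 2 * c / pi\<^sup>2 * t"
proof -
  have solve: "a = b + 2 * x + 2 * y + 2 * z" if "(a - b) / 2 = x + y + z" for a b x y z :: real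
    using that by simp
  have "2 * (- (s * p / (4 * pi)) * (- (A + 2 * e) / (2 * p\<^sup>2))) = s / (4 * p * pi) * A + s * e / (2 * p * pi)"
    using p by (simp add: divide_simps) (simp add: power2_eq_square algebra_simps)
  moreover have "l / 2 * (s / (p * pi)) + s * e / (2 * p * pi) = s * (e + l) / (2 * p * pi)"
    using p by (simp add: divide_simps) (simp add: algebra_simps)
  ultimately have "l / 2 * (s / (p * pi)) + 2 * (- (s * p / (4 * pi)) * (- (A + 2 * e) / (2 * p\<^sup>2)))
      = s * (e + l) / (2 * p * pi) + s / (4 * p * pi) * A"
    by linarith
  moreover have "2 * ((e + l) * (c / pi\<^sup>2 * q)) = 2 * c * (e + l) / pi\<^sup>2 * q"
    and "2 * (c / pi\<^sup>2 * t) = 2 * c / pi\<^sup>2 * t"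
    by simp_all
  ultimately show ?thesis unfolding solve[OF eq] by (simp only:)
qed

theorem mainTheorem1:
  fixes p :: real
  assumes not_even: "\<And>k :: int. p \<noteq> 2 * real_of_int k"
  shows "(\<lambda>x :: real. ln (Gamma x) * cos (p * pi * x)) absolutely_integrable_on {0..1}
    \<and> summable (\<lambda>n :: nat. ln (real (Suc n)) / (4 * (real (Suc n))\<^sup>2 - p\<^sup>2))
    \<and> integral {0..1} (\<lambda>x :: real. ln (Gamma x) * cos (p * pi * x)) =
        sin (p * pi) * (euler_mascheroni + ln (2 * pi)) / (2 * p * pi)
      + sin (p * pi) / (4 * p * pi) * (Digamma (p / 2) + Digamma (- p / 2))
      + 2 * (1 - cos (p * pi)) * (euler_mascheroni + ln (2 * pi)) / pi\<^sup>2
          * (1 / (2 * p\<^sup>2) - pi / (4 * p) * cot (p * pi / 2))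
      + 2 * (1 - cos (p * pi)) / pi\<^sup>2
          * (\<Sum>n :: nat. ln (real (Suc n)) / (4 * (real (Suc n))\<^sup>2 - p\<^sup>2))"
proof (intro conjI)
  have p: "p \<noteq> 0" using not_even[of 0] by simp
  show "(\<lambda>x :: real. ln (Gamma x) * cos (p * pi * x)) absolutely_integrable_on {0..1}"
    by (intro abs_integrable_mult_continuous ln_Gamma_absolutely_integrable continuous_intros)
  show sL: "summable (\<lambda>n :: nat. ln (real (Suc n)) / (4 * (real (Suc n))\<^sup>2 - p\<^sup>2))"
    by (subst summable_Suc_iff) (rule summable_ln_over_square[OF not_even])
  define T where "T = (\<Sum>n :: nat. ln (real (Suc n)) / (4 * (real (Suc n))\<^sup>2 - p\<^sup>2))"
  define J where "J = integral {0..1} (\<lambda>x :: real. ln (Gamma x) * cos (p * pi * x))"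
  define g where "g = euler_mascheroni + ln (2 * pi)"
  define s c where "s = sin (p * pi)" and "c = (1 - cos (p * pi)) / pi\<^sup>2"
  have "(\<lambda>n. fourier_cos (\<lambda>x. ln (Gamma x)) (Suc n) * (- sin (p * pi) * p / (pi * (4 * (real (Suc n))\<^sup>2 - p\<^sup>2)))
         + fourier_sin (\<lambda>x. ln (Gamma x)) (Suc n) * ((1 - cos (p * pi)) * (2 * real (Suc n)) / (pi * (4 * (real (Suc n))\<^sup>2 - p\<^sup>2))))
     sums ((J - integral {0..1} (\<lambda>x::real. ln (Gamma x)) * (sin (p * pi) / (p * pi))) / 2)"
    unfolding J_def
    by (intro cos_p_parseval[OF not_even] ln_Gamma_absolutely_integrable continuous_on_ln_Gamma_real
          summable_fourier_ln_Gamma) auto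
  moreover have "fourier_cos (\<lambda>x. ln (Gamma x)) (Suc n) * (- sin (p * pi) * p / (pi * (4 * (real (Suc n))\<^sup>2 - p\<^sup>2)))
         + fourier_sin (\<lambda>x. ln (Gamma x)) (Suc n) * ((1 - cos (p * pi)) * (2 * real (Suc n)) / (pi * (4 * (real (Suc n))\<^sup>2 - p\<^sup>2)))
      = - (s * p / (4 * pi)) * (1 / (real (Suc n) * (4 * (real (Suc n))\<^sup>2 - p\<^sup>2)))
        + g * (c * (1 / (4 * (real (Suc n))\<^sup>2 - p\<^sup>2)))
        + c * (ln (real (Suc n)) / (4 * (real (Suc n))\<^sup>2 - p\<^sup>2))" (is "?l n = ?r n") for n
  proof -
    define N D where "N = real (Suc n)" and "D = 4 * N\<^sup>2 - p\<^sup>2"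
    have N: "N > 0" by (simp add: N_def)
    have ln: "ln (2 * pi * N) = ln (2 * pi) + ln N" using N by (intro ln_mult_pos) auto
    have "?l n = 1 / (4 * N) * (- s * p / (pi * D))
        + (g + ln N) / (2 * pi * N) * ((1 - cos (p * pi)) * (2 * N) / (pi * D))"
      unfolding fourier_cos_ln_Gamma[OF zero_less_Suc] fourier_sin_ln_Gamma[OF zero_less_Suc]
      unfolding N_def[symmetric] D_def[symmetric] s_def[symmetric] ln g_def by (simp only: add.assoc)
    also have "(g + ln N) / (2 * pi * N) * ((1 - cos (p * pi)) * (2 * N) / (pi * D)) = (g + ln N) * (c / D)"
      using N by (simp add: c_def power2_eq_square)
    finally show ?thesis
      unfolding N_def[symmetric] D_def[symmetric] by (simp add: algebra_simps add_divide_distrib)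
  qed
  ultimately have "?r sums ((J - integral {0..1} (\<lambda>x::real. ln (Gamma x)) * (sin (p * pi) / (p * pi))) / 2)"
    by (simp only:)
  moreover have "?r sums (- (s * p / (4 * pi))
        * (- (Digamma (p / 2) + Digamma (- p / 2) + 2 * euler_mascheroni) / (2 * p\<^sup>2))
      + g * ((1 - cos (p * pi)) / pi\<^sup>2 * (1 / (2 * p\<^sup>2) - pi / (4 * p) * cot (p * pi / 2)))
      + c * T)"
    unfolding c_def T_def
    by (intro sums_add sums_mult digamma_sums[OF not_even] cot_sums[OF not_even] summable_sums sL)
  ultimately have "(J - ln (2 * pi) / 2 * (s / (p * pi))) / 2 = - (s * p / (4 * pi))
        * (- (Digamma (p / 2) + Digamma (- p / 2) + 2 * euler_mascheroni) / (2 * p\<^sup>2))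
      + g * ((1 - cos (p * pi)) / pi\<^sup>2 * (1 / (2 * p\<^sup>2) - pi / (4 * p) * cot (p * pi / 2)))
      + c * T"
    unfolding integral_ln_Gamma s_def by (rule sums_unique2)
  from solve_parseval_for_integral[OF this[unfolded g_def c_def s_def] p]
  show "integral {0..1} (\<lambda>x :: real. ln (Gamma x) * cos (p * pi * x)) =
        sin (p * pi) * (euler_mascheroni + ln (2 * pi)) / (2 * p * pi)
      + sin (p * pi) / (4 * p * pi) * (Digamma (p / 2) + Digamma (- p / 2))
      + 2 * (1 - cos (p * pi)) * (euler_mascheroni + ln (2 * pi)) / pi\<^sup>2
          * (1 / (2 * p\<^sup>2) - pi / (4 * p) * cot (p * pi / 2))
      + 2 * (1 - cos (p * pi)) / pi\<^sup>2
          * (\<Sum>n :: nat. ln (real (Suc n)) / (4 * (real (Suc n))\<^sup>2 - p\<^sup>2))"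
    unfolding J_def T_def .
qed

end
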